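(* Let $a$ and $\lambda$ be complex numbers and let $m,n$ be nonnegative integers, such that all terms below are well defined (for $0\le k\le n$, $0\le i\le m$ no Gamma function in a numerator is evaluated at a pole, and the denominator on the right-hand side is nonzero). For $0\le i\le m$ put $$\Theta(\lambda,a,i,m,n)=\sum_{k=0}^{n}\frac{N_i(k)}{D_i(k)}\,\frac{(-1)^k}{k!},$$ where $$N_i(k)=\Gamma(1+k)\,\Gamma(\tfrac32+k)\,\Gamma(\tfrac{m-i}{2}+\lambda-a+\lambda k)\,\Gamma(\tfrac{1+m-i}{2}+\lambda-a+(1+\lambda)k)\,\Gamma(\tfrac{3+m}{2}-i+\lambda+(1+2\lambda)k)\,\Gamma(\tfrac{2+m}{2}+\lambda+(1+2\lambda)k)\,\Gamma(1+2a+n+(1+2\lambda)k)\,\Gamma(1-i+2\lambda+(2+4\lambda)k),$$ $$D_i(k)=\Gamma(1+n-k)\,\Gamma(2+n+k)\,\Gamma(\tfrac12+k)\,\Gamma(\tfrac{2-i}{2}+a+\lambda k)\,\Gamma(\tfrac{3-i}{2}+a+(1+\lambda)k)\,\Gamma(\tfrac{1+m}{2}-i+\lambda+(1+2\lambda)k)\,\Gamma(\tfrac{2-m}{2}+\lambda+(1+2\lambda)k)\,\Gamma(1+2\lambda-2a-n+(1+2\lambda)k)\,\Gamma(2+m-i+2\lambda+(2+4\lambda)k).$$ Then $$\sum_{i=0}^m\frac{(-m)_i}{i!}\,\Theta(\lambda,a,i,m,n)=\frac{(-1)^{n}\,2^{4a-2\lambda-m-1}\,(1+2a-\lambda+\tfrac{m}{2})_n\,(\lambda-2a-\tfrac{m}{2})_m}{(1+2a+2\lambda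 n+2n)(\lambda-a+\lambda n)\,(1)_n}.$$
   Context: $(x)_0=1$ and $(x)_n=x(x+1)\cdots(x+n-1)$ for $n\ge 1$ is the shifted factorial. $\Gamma$ is the gamma function (meromorphically continued), with $1/\Gamma$ entire, so $1/\Gamma$ is $0$ at the poles of $\Gamma$ (a factor $\Gamma$ in $D_i(k)$ is to be read as a factor $1/\Gamma$ in $1/D_i(k)$). For complex $s$, $2^s=e^{s\log 2}$. $\Theta(\lambda,a,i,m,n)$ is the value at $z=-1$ of a terminating Fox-Wright function ${}_8\Psi_9$, where in general ${}_p\Psi_q[z]=\sum_{k\ge0}\frac{\prod_{i=1}^p\Gamma(\alpha_i+A_ik)}{\prod_{j=1}^q\Gamma(\beta_j+B_jk)}\frac{z^k}{k!}$; the factor $1/\Gamma(1+n-k)$ makes the series terminate at $k=n$. *)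

theory Defs
  imports "HOL-Analysis.Analysis"
begin

text \<open>
  The indices \<open>i\<close>, \<open>m\<close>, \<open>n\<close>, \<open>k\<close> are natural numbers but are passed to the two lists below as
  complex numbers, so that differences such as \<open>m - i\<close> and \<open>n - k\<close> are not truncated.
  The numerator \<open>N_i(k)\<close> is the product of \<open>Gamma\<close> over \<open>N_args\<close>, and the denominator \<open>D_i(k)\<close>
  is the product of \<open>Gamma\<close> over \<open>D_args\<close>.
\<close>

definition N_args :: "complex \<Rightarrow> complex \<Rightarrow> complex \<Rightarrow> complex \<Rightarrow> complex \<Rightarrow> complex \<Rightarrow> complex list"
  where "N_args lam a i m n k =
    [1 + k,
     3 / 2 + k,
     (m - i) / 2 + lam - a + lam * k,
     (1 + m - i) / 2 + lam - a + (1 + lam) * k,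
     (3 + m) / 2 - i + lam + (1 + 2 * lam) * k,
     (2 + m) / 2 + lam + (1 + 2 * lam) * k,
     1 + 2 * a + n + (1 + 2 * lam) * k,
     1 - i + 2 * lam + (2 + 4 * lam) * k]"

definition D_args :: "complex \<Rightarrow> complex \<Rightarrow> complex \<Rightarrow> complex \<Rightarrow> complex \<Rightarrow> complex \<Rightarrow> complex list"
  where "D_args lam a i m n k =
    [1 + n - k,
     2 + n + k,
     1 / 2 + k,
     (2 - i) / 2 + a + lam * k,
     (3 - i) / 2 + a + (1 + lam) * k,
     (1 + m) / 2 - i + lam + (1 + 2 * lam) * k,
     (2 - m) / 2 + lam + (1 + 2 * lam) * k,
     1 + 2 * lam - 2 * a - n + (1 + 2 * lam) * k,
     2 + m - i + 2 * lam + (2 + 4 * lam) * k]"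

text \<open>
  The reciprocal \<open>1 / Gamma\<close> is written as the entire function \<open>rGamma\<close>, which vanishes at the
  poles of \<open>Gamma\<close>: the denominator parameters may be nonpositive integers.
\<close>

definition Theta :: "complex \<Rightarrow> complex \<Rightarrow> nat \<Rightarrow> nat \<Rightarrow> nat \<Rightarrow> complex"
  where "Theta lam a i m n =
    (\<Sum>k=0..n. prod_list (map Gamma (N_args lam a (of_nat i) (of_nat m) (of_nat n) (of_nat k)))
      * prod_list (map rGamma (D_args lam a (of_nat i) (of_nat m) (of_nat n) (of_nat k)))
      * ((- 1) ^ k / fact k))"

end

theory Submission
  imports Defs
begin

text \<open>
  Put \<open>u = k + 1/2\<close>, \<open>v = (1 + 2 lam) u\<close> and \<open>\<beta> = lam - 2 a\<close>. In these variables the Gamma factors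
  that couple \<open>i\<close> and \<open>k\<close> form a quotient that Whipple's summation identifies with a terminating
  \<open>3F2(-k, k + 1, c; e, f; 1)\<close>, \<open>e + f = 2 c + 1\<close>. Expanding it and interchanging the sums, the sum
  over \<open>i\<close> becomes a very well poised \<open>4F3(1)\<close> with a closed form. The weight
  \<open>(-1)^k u / ((n - k)! (n + k + 1)!)\<close> is, up to a constant, the weight of the \<open>n\<close>-th divided difference
  at the nodes \<open>u^2\<close>. Hence all terms of the expansion except the last one, being polynomials in
  \<open>u^2\<close> of degree less than \<open>n\<close>, drop out, and the last one is the right-hand side.
  This argument divides by quantities that vanish for special parameters, which are
  reached by continuity along the line \<open>(lam + 2 t, a + t)\<close>, on which \<open>\<beta>\<close> is constant.
\<close>

section \<open>Non-integrality under integer translation\<close>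

lemma not_Ints_translate:
  fixes z w :: complex
  assumes "z \<notin> \<int>" "w - z \<in> \<int>"
  shows "w \<notin> \<int>"
  using Ints_diff[of w "w - z"] assms by auto

lemma not_Ints_translate_nonzero:
  fixes z w :: complex
  assumes "z \<notin> \<int>" "w - z \<in> \<int>"
  shows "w \<noteq> 0"
  using not_Ints_translate[OF assms] by auto

lemma pochhammer_translate_nonzero:
  fixes z w :: complex
  assumes "z \<notin> \<int>" "w - z \<in> \<int>"
  shows "pochhammer w k \<noteq> 0"
  using not_Ints_translate[OF assms] by (auto simp: pochhammer_eq_0_iff)

subsection \<open>Two hypergeometric summations\<close>

text \<open>
  Wilf-Zeilberger certificate for the passage from \<open>(N, y + 1)\<close> to \<open>(N + 1, y)\<close>, the shift under which
  the value of Whipple's sum changes by a rational factor.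
\<close>

lemma whipple_telescope:
  fixes P y M :: complex
  assumes "P + y \<notin> \<int>" "P - y \<notin> \<int>"
  shows "(\<Sum>k\<le>K. (y - 1 - M - P) * (P + y) *
             (pochhammer (- M - 1) k * pochhammer (M + 2) k * pochhammer (P + 1/2) k /
              (fact k * pochhammer (P - y) (Suc k) * pochhammer (P + y) (Suc k)))
           - (y - M + P) * (y + 1 - P) *
             (pochhammer (- M) k * pochhammer (M + 1) k * pochhammer (P + 1/2) k /
              (fact k * pochhammer (P - y - 1) (Suc k) * pochhammer (P + y + 1) (Suc k))))
         = - 2 * (M + 1) * pochhammer (P + 1/2) (Suc K) * pochhammer (- M) K * pochhammer (M + 2) K /
             (fact K * pochhammer (P - y) (Suc K) * pochhammer (P + y + 1) (Suc K))"
proof (induction K)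
  case 0
  have "P + y \<noteq> 0" "P + y + 1 \<noteq> 0"
    by (rule not_Ints_translate_nonzero[OF assms(1)]; simp)+
  moreover have "P - y \<noteq> 0" "P - y - 1 \<noteq> 0"
    by (rule not_Ints_translate_nonzero[OF assms(2)]; simp)+
  ultimately show ?case
    by (simp add: divide_simps) algebra
next
  case (Suc K)
  define k where "k = (of_nat (Suc K) :: complex)"
  \<comment> \<open>The factor shared by all terms of the inductive step. Dividing by it leaves an
    identity between rational functions of \<open>P\<close>, \<open>y\<close>, \<open>M\<close> and
    \<open>k\<close>, which is the certificate itself.\<close>
  define E where "E = pochhammer (P + 1/2) (Suc K) * pochhammer (- M) K * pochhammer (M + 2) K /
             (fact (Suc K) * pochhammer (P - y) (Suc K) * pochhammer (P + y + 1) (Suc K))"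
  \<comment> \<open>Each factor that is cancelled differs by an integer from \<open>P + y\<close> or
    \<open>P - y\<close>, except \<open>k\<close>, which is a successor.\<close>
  have nz: "P + y \<noteq> 0" "P + y + 1 + k \<noteq> 0" "P + y + (1 + k) \<noteq> 0" "pochhammer (P + y + 1) (Suc K) \<noteq> 0"
      "P - y - 1 \<noteq> 0" "P - y + k \<noteq> 0" "pochhammer (P - y) (Suc K) \<noteq> 0" "k \<noteq> 0"
    by (simp_all only: k_def of_nat_eq_0_iff nat.distinct not_False_eq_True)
       (rule not_Ints_translate_nonzero[OF assms(1)] not_Ints_translate_nonzero[OF assms(2)]
         pochhammer_translate_nonzero[OF assms(1)] pochhammer_translate_nonzero[OF assms(2)]; simp; fail)+
  have e1: "pochhammer (- M - 1) (Suc K) = (- M - 1) * pochhammer (- M) K"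
    by (simp add: pochhammer_rec)
  have e2: "pochhammer (M + 2) (Suc K) = pochhammer (M + 2) K * (M + 1 + k)"
    by (simp add: pochhammer_Suc k_def algebra_simps)
  have e3: "pochhammer (P - y) (Suc (Suc K)) = pochhammer (P - y) (Suc K) * (P - y + k)"
    by (simp only: pochhammer_Suc k_def)
  have e4: "pochhammer (P + y) (Suc (Suc K)) = (P + y) * pochhammer (P + y + 1) (Suc K)"
    by (simp only: pochhammer_rec)
  have e5: "pochhammer (- M) (Suc K) = pochhammer (- M) K * (k - 1 - M)"
    by (simp add: pochhammer_Suc k_def algebra_simps)
  have e6: "pochhammer (M + 1) (Suc K) = (M + 1) * pochhammer (M + 2) K"
    by (simp add: pochhammer_rec add_ac)
  have e7: "pochhammer (P - y - 1) (Suc (Suc K)) = (P - y - 1) * pochhammer (P - y) (Suc K)"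
    using pochhammer_rec[of "P - y - 1" "Suc K"] by simp
  have e8: "pochhammer (P + y + 1) (Suc (Suc K)) = pochhammer (P + y + 1) (Suc K) * (P + y + 1 + k)"
    by (simp only: pochhammer_Suc k_def)
  have e9: "pochhammer (P + 1/2) (Suc (Suc K)) = pochhammer (P + 1/2) (Suc K) * (P + 1/2 + k)"
    by (simp only: pochhammer_Suc k_def)
  have t1: "(y - 1 - M - P) * (P + y) *
             (pochhammer (- M - 1) (Suc K) * pochhammer (M + 2) (Suc K) * pochhammer (P + 1/2) (Suc K) /
              (fact (Suc K) * pochhammer (P - y) (Suc (Suc K)) * pochhammer (P + y) (Suc (Suc K))))
      = E * ((y - 1 - M - P) * (- M - 1) * (M + 1 + k) / (P - y + k))"
    unfolding e1 e2 e3 e4 E_def using nz by (simp add: divide_simps del: fact_Suc)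
  have t2: "(y - M + P) * (y + 1 - P) *
             (pochhammer (- M) (Suc K) * pochhammer (M + 1) (Suc K) * pochhammer (P + 1/2) (Suc K) /
              (fact (Suc K) * pochhammer (P - y - 1) (Suc (Suc K)) * pochhammer (P + y + 1) (Suc (Suc K))))
      = E * ((y - M + P) * (-1) * (k - 1 - M) * (M + 1) / (P + y + 1 + k))"
  proof -
    have "(y - M + P) * (y + 1 - P) *
             (pochhammer (- M) (Suc K) * pochhammer (M + 1) (Suc K) * pochhammer (P + 1/2) (Suc K) /
              (fact (Suc K) * pochhammer (P - y - 1) (Suc (Suc K)) * pochhammer (P + y + 1) (Suc (Suc K))))
      = (y + 1 - P) / (P - y - 1) * (E * ((y - M + P) * (k - 1 - M) * (M + 1) / (P + y + 1 + k)))"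
      unfolding e5 e6 e7 e8 E_def using nz by (simp add: divide_simps del: fact_Suc)
    also have "(y + 1 - P) / (P - y - 1) = -1"
      using nz(5) by (simp add: divide_simps)
    finally show ?thesis
      by (simp only: mult_1_right mult_1_left mult_minus_left mult_minus_right
          minus_divide_left[symmetric])
  qed
  have t3: "- 2 * (M + 1) * pochhammer (P + 1/2) (Suc (Suc K)) * pochhammer (- M) (Suc K) * pochhammer (M + 2) (Suc K) /
             (fact (Suc K) * pochhammer (P - y) (Suc (Suc K)) * pochhammer (P + y + 1) (Suc (Suc K)))
     = E * (- 2 * (M + 1) * (P + 1/2 + k) * (k - 1 - M) * (M + 1 + k) / ((P - y + k) * (P + y + 1 + k)))"
    unfolding e2 e3 e5 e8 e9 E_def using nz by (simp add: divide_simps del: fact_Suc)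
  have t4: "- 2 * (M + 1) * pochhammer (P + 1/2) (Suc K) * pochhammer (- M) K * pochhammer (M + 2) K /
             (fact K * pochhammer (P - y) (Suc K) * pochhammer (P + y + 1) (Suc K))
     = E * (- 2 * (M + 1) * k)"
    unfolding E_def fact_Suc k_def[symmetric] using nz by (simp add: divide_simps)
  have "- 2 * (M + 1) * k + ((y - 1 - M - P) * (- M - 1) * (M + 1 + k) / (P - y + k)
          - (y - M + P) * (-1) * (k - 1 - M) * (M + 1) / (P + y + 1 + k))
       = - 2 * (M + 1) * (P + 1/2 + k) * (k - 1 - M) * (M + 1 + k) / ((P - y + k) * (P + y + 1 + k))"
    using nz(6,2) by (simp add: divide_simps) algebra
  then have "E * (- 2 * (M + 1) * k) + (E * ((y - 1 - M - P) * (- M - 1) * (M + 1 + k) / (P - y + k))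
          - E * ((y - M + P) * (-1) * (k - 1 - M) * (M + 1) / (P + y + 1 + k)))
       = E * (- 2 * (M + 1) * (P + 1/2 + k) * (k - 1 - M) * (M + 1 + k) / ((P - y + k) * (P + y + 1 + k)))"
    by (metis distrib_left right_diff_distrib)
  then show ?case
    unfolding sum.atMost_Suc Suc.IH t1 t2 t3 t4 .
qed

text \<open>Wilf-Zeilberger certificate for the passage from \<open>M\<close> to \<open>M + 1\<close> at fixed \<open>A\<close> and \<open>b\<close>.\<close>

lemma very_well_poised_telescope:
  fixes A b M :: complex
  assumes "A + M \<notin> \<int>" "A - b \<notin> \<int>" "2 * M + A \<notin> \<int>" "1 + A - b + M \<noteq> 0"
  shows "(\<Sum>i\<le>K. (A + 2 * of_nat i) * (pochhammer A i * pochhammer b i * pochhammer (- M - 1) i /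
             (fact i * pochhammer (1 + A - b) i * pochhammer (2 + A + M) i))
           - (1 + A + M) * ((1 + A) / 2 - b + M) / ((1 + A - b + M) * ((1 + A) / 2 + M)) *
             ((A + 2 * of_nat i) * (pochhammer A i * pochhammer b i * pochhammer (- M) i /
             (fact i * pochhammer (1 + A - b) i * pochhammer (1 + A + M) i))))
     = (1 + A + M) / ((1 + A - b + M) * ((1 + A) / 2 + M)) * ((1 + A) / 2 + of_nat K) *
        (pochhammer A (Suc K) * pochhammer b (Suc K) * pochhammer (- M) K /
             (fact K * pochhammer (1 + A - b) K * pochhammer (1 + A + M) (Suc K)))"
proof (induction K)
  case 0
  have "1 + A + M \<noteq> 0" "1 + A + 2 * M \<noteq> 0"
    by (rule not_Ints_translate_nonzero[OF assms(1)] not_Ints_translate_nonzero[OF assms(3)]; simp; fail)+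
  then show ?case using assms(4)
    by (simp add: divide_simps) algebra
next
  case (Suc K)
  define k where "k = (of_nat (Suc K) :: complex)"
  define r where "r = (1 + A + M) * ((1 + A) / 2 - b + M) / ((1 + A - b + M) * ((1 + A) / 2 + M))"
  define s where "s = (1 + A + M) / ((1 + A - b + M) * ((1 + A) / 2 + M))"
  define E where "E = pochhammer A (Suc K) * pochhammer b (Suc K) * pochhammer (- M) K /
             (fact (Suc K) * pochhammer (1 + A - b) (Suc K) * pochhammer (1 + A + M) (Suc K))"
  have nz: "1 + A + M \<noteq> 0" "1 + A + 2 * M \<noteq> 0" "1 + A + M + k \<noteq> 0" "A - b + k \<noteq> 0" "k \<noteq> 0"
    "pochhammer (1 + A - b) (Suc K) \<noteq> 0" "pochhammer (1 + A + M) (Suc K) \<noteq> 0"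
    "pochhammer (1 + A - b) K \<noteq> 0"
    by (simp_all only: k_def of_nat_eq_0_iff nat.distinct not_False_eq_True)
       (rule not_Ints_translate_nonzero[OF assms(1)] not_Ints_translate_nonzero[OF assms(2)]
         not_Ints_translate_nonzero[OF assms(3)] pochhammer_translate_nonzero[OF assms(1)]
         pochhammer_translate_nonzero[OF assms(2)]; simp; fail)+
  have e1: "pochhammer (- M - 1) (Suc K) = (- M - 1) * pochhammer (- M) K"
    by (simp add: pochhammer_rec)
  have e2: "pochhammer (- M) (Suc K) = pochhammer (- M) K * (k - 1 - M)"
    by (simp add: pochhammer_Suc k_def algebra_simps)
  have e3: "pochhammer (1 + A + M) (Suc (Suc K)) = pochhammer (1 + A + M) (Suc K) * (1 + A + M + k)"
    by (simp only: pochhammer_Suc k_def)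
  have e4: "pochhammer (2 + A + M) (Suc K) = pochhammer (1 + A + M) (Suc K) * (1 + A + M + k) / (1 + A + M)"
    using nz(1) pochhammer_rec[of "1 + A + M" "Suc K"] e3 by (simp add: add_ac field_simps)
  have e5: "pochhammer A (Suc (Suc K)) = pochhammer A (Suc K) * (A + k)"
    by (simp only: pochhammer_Suc k_def)
  have e6: "pochhammer b (Suc (Suc K)) = pochhammer b (Suc K) * (b + k)"
    by (simp only: pochhammer_Suc k_def)
  have e7: "pochhammer (1 + A - b) (Suc K) = pochhammer (1 + A - b) K * (A - b + k)"
    by (simp add: pochhammer_Suc k_def algebra_simps)
  have t1: "(A + 2 * of_nat (Suc K)) * (pochhammer A (Suc K) * pochhammer b (Suc K) * pochhammer (- M - 1) (Suc K) /
             (fact (Suc K) * pochhammer (1 + A - b) (Suc K) * pochhammer (2 + A + M) (Suc K)))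
     = E * ((A + 2 * k) * (- M - 1) * (1 + A + M) / (1 + A + M + k))"
    unfolding e1 e4 E_def k_def[symmetric] using nz by (simp add: divide_simps del: fact_Suc)
  have t2: "r * ((A + 2 * of_nat (Suc K)) * (pochhammer A (Suc K) * pochhammer b (Suc K) * pochhammer (- M) (Suc K) /
             (fact (Suc K) * pochhammer (1 + A - b) (Suc K) * pochhammer (1 + A + M) (Suc K))))
     = E * (r * (A + 2 * k) * (k - 1 - M))"
    unfolding e2 E_def k_def[symmetric] using nz by (simp add: divide_simps del: fact_Suc)
  have t3: "s * ((1 + A) / 2 + of_nat (Suc K)) *
        (pochhammer A (Suc (Suc K)) * pochhammer b (Suc (Suc K)) * pochhammer (- M) (Suc K) /
             (fact (Suc K) * pochhammer (1 + A - b) (Suc K) * pochhammer (1 + A + M) (Suc (Suc K))))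
     = E * (s * ((1 + A) / 2 + k) * (A + k) * (b + k) * (k - 1 - M) / (1 + A + M + k))"
  proof -
    have "2 + 2 * A + 2 * M + 2 * k \<noteq> 0"
      using nz(3) by algebra
    then show ?thesis
      unfolding e2 e3 e5 e6 E_def k_def[symmetric] using nz by (simp add: divide_simps del: fact_Suc)
  qed
  have t4: "s * ((1 + A) / 2 + of_nat K) *
        (pochhammer A (Suc K) * pochhammer b (Suc K) * pochhammer (- M) K /
             (fact K * pochhammer (1 + A - b) K * pochhammer (1 + A + M) (Suc K)))
     = E * (s * ((1 + A) / 2 + (k - 1)) * k * (A - b + k))"
  proof -
    have "of_nat K = k - 1" by (simp add: k_def)
    then show ?thesis
    unfolding e7 E_def fact_Suc k_def[symmetric] using nz by (simp add: divide_simps)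
  qed
  have r: "r = s * ((1 + A) / 2 - b + M)" by (simp add: r_def s_def)
  \<comment> \<open>Once \<open>1 + A + M\<close> is written as a multiple of \<open>s\<close>, all
    terms carry the factor \<open>s\<close>, and clearing the denominator
    \<open>1 + A + M + k\<close> leaves a polynomial identity.\<close>
  have q: "1 + A + M = s * ((1 + A - b + M) * ((1 + A) / 2 + M))"
  proof -
    have "(1 + A) / 2 + M \<noteq> 0"
      using nz(2) by (simp add: field_simps)
    then show ?thesis
      using assms(4) by (simp add: s_def)
  qed
  have q': "(A + 2 * k) * (- M - 1) * (1 + A + M) =
      (A + 2 * k) * (- M - 1) * (s * ((1 + A - b + M) * ((1 + A) / 2 + M)))"
    using q by (rule arg_cong)
  have "(s * ((1 + A) / 2 + (k - 1)) * k * (A - b + k) +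
        ((A + 2 * k) * (- M - 1) * (1 + A + M) / (1 + A + M + k) - r * (A + 2 * k) * (k - 1 - M))
     - s * ((1 + A) / 2 + k) * (A + k) * (b + k) * (k - 1 - M) / (1 + A + M + k)) * (1 + A + M + k)
      = s * ((1 + A) / 2 + (k - 1)) * k * (A - b + k) * (1 + A + M + k) +
        ((A + 2 * k) * (- M - 1) * (1 + A + M) - r * (A + 2 * k) * (k - 1 - M) * (1 + A + M + k))
     - s * ((1 + A) / 2 + k) * (A + k) * (b + k) * (k - 1 - M)"
    using nz(3) by (simp add: divide_simps) algebra
  also have "\<dots> = s * ((1 + A) / 2 + (k - 1)) * k * (A - b + k) * (1 + A + M + k) +
        ((A + 2 * k) * (- M - 1) * (s * ((1 + A - b + M) * ((1 + A) / 2 + M))) - r * (A + 2 * k) * (k - 1 - M) * (1 + A + M + k))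
     - s * ((1 + A) / 2 + k) * (A + k) * (b + k) * (k - 1 - M)"
    by (simp only: q')
  also have "\<dots> = 0"
    unfolding r by (simp add: divide_simps) algebra
  finally have "s * ((1 + A) / 2 + (k - 1)) * k * (A - b + k) +
        ((A + 2 * k) * (- M - 1) * (1 + A + M) / (1 + A + M + k) - r * (A + 2 * k) * (k - 1 - M))
     = s * ((1 + A) / 2 + k) * (A + k) * (b + k) * (k - 1 - M) / (1 + A + M + k)"
    using nz(3) by simp
  then have "E * (s * ((1 + A) / 2 + (k - 1)) * k * (A - b + k)) +
        (E * ((A + 2 * k) * (- M - 1) * (1 + A + M) / (1 + A + M + k)) - E * (r * (A + 2 * k) * (k - 1 - M)))
     = E * (s * ((1 + A) / 2 + k) * (A + k) * (b + k) * (k - 1 - M) / (1 + A + M + k))"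
    by (metis distrib_left right_diff_distrib)
  then show ?case
    unfolding sum.atMost_Suc Suc.IH
    unfolding r_def[symmetric] s_def[symmetric] t1 t2 t3 t4 .
qed

text \<open>This is the terminating very well poised \<open>5F4(1)\<close> with one more parameter
  set to \<open>(1 + A) / 2\<close>, which cancels against its partner and leaves a
  \<open>4F3\<close>; the factor \<open>A + 2 i\<close> is the very well poised pair
  \<open>1 + A/2\<close>, \<open>A/2\<close> times \<open>A\<close>. Induction on \<open>m\<close>:
  the telescoped identity, summed far enough for its right side to vanish, says that passing to
  \<open>m + 1\<close> multiplies the sum by \<open>r\<close>.\<close>

lemma very_well_poised_sum:
  fixes A b :: complex
  assumes "A \<notin> \<int>" "A - b \<notin> \<int>"
  shows "(\<Sum>i\<le>m. (A + 2 * of_nat i) * (pochhammer A i * pochhammer b i * pochhammer (- of_nat m) i /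
             (fact i * pochhammer (1 + A - b) i * pochhammer (1 + A + of_nat m) i)))
    = A * pochhammer (1 + A) m * pochhammer ((1 + A) / 2 - b) m /
        (pochhammer (1 + A - b) m * pochhammer ((1 + A) / 2) m)"
proof (induction m)
  case 0
  then show ?case by simp
next
  case (Suc m)
  define M where "M = (of_nat m :: complex)"
  have M: "of_nat (Suc m) = M + 1"
    by (simp add: M_def)
  define r where "r = (1 + A + M) * ((1 + A) / 2 - b + M) / ((1 + A - b + M) * ((1 + A) / 2 + M))"
  define t where "t = (\<lambda>i. (A + 2 * of_nat i) * (pochhammer A i * pochhammer b i * pochhammer (- M) i /
             (fact i * pochhammer (1 + A - b) i * pochhammer (1 + A + M) i)))"
  define t' where "t' = (\<lambda>i. (A + 2 * of_nat i) * (pochhammer A i * pochhammer b i * pochhammer (- M - 1) i /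
             (fact i * pochhammer (1 + A - b) i * pochhammer (2 + A + M) i)))"
  \<comment> \<open>Besides killing the boundary term of the telescoped sum, this removes the extra
    last term from the sum for \<open>m\<close>.\<close>
  have zero: "pochhammer (- M) (Suc m) = 0"
    by (simp add: M_def pochhammer_of_nat_eq_0_iff del: pochhammer_Suc)
  have nz: "1 + A - b + M \<noteq> 0" "A + M \<notin> \<int>" "2 * M + A \<notin> \<int>"
    by (rule not_Ints_translate_nonzero[OF assms(2)] not_Ints_translate[OF assms(1)]; simp add: M_def; fail)+
  have "(\<Sum>i\<le>Suc m. t' i - r * t i) = 0"
    unfolding t_def t'_def r_def very_well_poised_telescope[OF nz(2) assms(2) nz(3,1)] zero by simp
  moreover have "(\<Sum>i\<le>Suc m. t i) = (\<Sum>i\<le>m. t i)"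
    using zero by (simp add: t_def del: pochhammer_Suc)
  ultimately have "(\<Sum>i\<le>Suc m. t' i) = r * (\<Sum>i\<le>m. t i)"
    by (simp only: sum_subtractf sum_distrib_left[symmetric]) simp
  also have "(\<Sum>i\<le>m. t i) = A * pochhammer (1 + A) m * pochhammer ((1 + A) / 2 - b) m /
        (pochhammer (1 + A - b) m * pochhammer ((1 + A) / 2) m)"
    using Suc.IH by (simp only: t_def M_def)
  also have "r * \<dots> = A * pochhammer (1 + A) (Suc m) * pochhammer ((1 + A) / 2 - b) (Suc m) /
        (pochhammer (1 + A - b) (Suc m) * pochhammer ((1 + A) / 2) (Suc m))"
    by (simp only: r_def pochhammer_Suc M_def[symmetric] times_divide_times_eq mult_ac)
  finally show ?case
    by (simp only: t'_def M minus_add_distrib diff_conv_add_uminus) (simp add: add_ac)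
qed

text \<open>Summing the certificate up to \<open>Suc N\<close> makes its right side vanish, because
  \<open>pochhammer (- of_nat N) (Suc N)\<close> is zero. What remains links
  \<open>(N + 1, y)\<close> with \<open>(N, y + 1)\<close>, the same shift as in the recurrence of
  the Gamma quotient below.\<close>

lemma whipple_sum_Suc:
  fixes P y :: complex
  assumes "P + y \<notin> \<int>" "P - y \<notin> \<int>"
  defines "t \<equiv> \<lambda>N y k. pochhammer (- of_nat N) k * pochhammer (of_nat N + 1) k * pochhammer (P + 1/2) k /
              (fact k * pochhammer (P - y) (Suc k) * pochhammer (P + y) (Suc k))"
  shows "(y - 1 - of_nat N - P) * (P + y) * (\<Sum>k\<le>Suc N. t (Suc N) y k)
       = (y - of_nat N + P) * (y + 1 - P) * (\<Sum>k\<le>N. t N (y + 1) k)"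
proof -
  have zero: "pochhammer (- of_nat N) (Suc N) = (0 :: complex)"
    by (simp add: pochhammer_of_nat_eq_0_iff del: pochhammer_Suc)
  have eqs: "- of_nat (Suc N) = - of_nat N - (1 :: complex)" "of_nat (Suc N) + 1 = (of_nat N + 2 :: complex)"
    "P - (y + 1) = P - y - 1" "P + (y + 1) = P + y + 1"
    by simp_all
  have "(\<Sum>k\<le>Suc N. (y - 1 - of_nat N - P) * (P + y) * t (Suc N) y k
                - (y - of_nat N + P) * (y + 1 - P) * t N (y + 1) k) = 0"
    unfolding t_def eqs whipple_telescope[OF assms(1,2)] zero by simp
  moreover have "(\<Sum>k\<le>Suc N. t N (y + 1) k) = (\<Sum>k\<le>N. t N (y + 1) k)"
    using zero by (simp add: t_def del: pochhammer_Suc)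
  ultimately show ?thesis
    by (simp only: sum_subtractf sum_distrib_left[symmetric]) simp
qed

text \<open>The value of Whipple's sum up to a factor. With \<open>g = \<beta> / 2 + m / 4\<close>,
  \<open>y = v + m / 2 - i\<close> and \<open>u = k + 1/2\<close> these are the four factors of the
  summand whose arguments contain \<open>lam * k\<close> or \<open>(1 + lam) * k\<close>.\<close>

definition gamma_quotient :: "complex \<Rightarrow> complex \<Rightarrow> complex \<Rightarrow> complex" where
  "gamma_quotient g y u = Gamma (g + (y - u) / 2) * Gamma (g + (y + u) / 2)
     * rGamma (1 - g + (y - u) / 2) * rGamma (1 - g + (y + u) / 2)"

text \<open>Both sides have the same \<open>y + u\<close>, while \<open>(y - u) / 2\<close> differs
  by one. So only one \<open>Gamma\<close> and one \<open>rGamma\<close> change, each by its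
  functional equation.\<close>

lemma gamma_quotient_rec:
  assumes "g + (y - 1 - u) / 2 \<notin> \<int>\<^sub>\<le>\<^sub>0"
  shows "(y - 1 - u + 2 * g) * gamma_quotient g y (u + 1) = (y + 1 - u - 2 * g) * gamma_quotient g (y + 1) u"
proof -
  define z where "z = g + (y - 1 - u) / 2"
  define w where "w = - g + (y + 1 - u) / 2"
  have "Gamma (z + 1) = z * Gamma z" "z \<noteq> 0"
    using assms by (auto simp: z_def intro: Gamma_plus1)
  moreover have "rGamma w = w * rGamma (w + 1)"
    by (simp add: rGamma_plus1)
  moreover have eqs: "g + (y - (u + 1)) / 2 = z" "g + (y + 1 - u) / 2 = z + 1"
    "1 - g + (y - (u + 1)) / 2 = w" "1 - g + (y + 1 - u) / 2 = w + 1"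
    "y - 1 - u + 2 * g = 2 * z" "y + 1 - u - 2 * g = 2 * w" "y + (u + 1) = y + 1 + u"
    by (simp_all add: z_def w_def field_simps)
  ultimately show ?thesis
    unfolding gamma_quotient_def eqs by simp
qed

lemma not_Ints_if_double_not_Ints: "2 * z \<notin> \<int> \<Longrightarrow> z \<notin> \<int>" for z :: complex
  by (metis Ints_mult Ints_numeral)

lemma Gamma_mult_Gamma_half:
  fixes z :: complex
  assumes "2 * z \<notin> \<int>"
  shows "Gamma z * Gamma (z + 1/2) = 2 powr (1 - 2 * z) * of_real (sqrt pi) * Gamma (2 * z)"
proof -
  have "z \<notin> \<int>\<^sub>\<le>\<^sub>0"
    using not_Ints_if_double_not_Ints[OF assms] nonpos_Ints_subset_Ints by blast
  moreover have "z + 1/2 \<notin> \<int>\<^sub>\<le>\<^sub>0"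
    using not_Ints_if_double_not_Ints[of "z + 1/2"] not_Ints_translate[OF assms, of "2 * (z + 1/2)"]
      nonpos_Ints_subset_Ints by (auto simp: algebra_simps)
  \<comment> \<open>The duplication formula is stated with the real \<open>ln 2\<close>, whereas
    \<open>powr\<close> uses the complex \<open>Ln 2\<close>.\<close>
  ultimately show ?thesis
    using Gamma_legendre_duplication[of z] Ln_of_real[of 2] by (simp add: powr_def)
qed

text \<open>At \<open>u = 1/2\<close> the two \<open>Gamma\<close> arguments differ by
  \<open>1/2\<close>, and so do the two \<open>rGamma\<close> arguments, so the duplication formula
  applies to each pair. This is the start of the induction for Whipple's sum.\<close>

lemma gamma_quotient_half:
  assumes "2 * g + y - 1/2 \<notin> \<int>" "2 * g - y - 1/2 \<notin> \<int>"
  shows "gamma_quotient g y (1/2) = 2 powr (2 - 4 * g) * Gamma (2 * g + y - 1/2) * rGamma (3/2 - 2 * g + y)"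
proof -
  define z w where "z = g + (y - 1/2) / 2" and "w = 1 - g + (y - 1/2) / 2"
  have z: "2 * z = 2 * g + y - 1/2"
    by (simp add: z_def field_simps)
  have "2 * z \<notin> \<int>"
    using assms(1) unfolding z .
  have w2: "2 * w = 3/2 - 2 * g + y"
    by (simp add: w_def field_simps)
  have "2 * w \<notin> \<int>"
  proof
    assume "2 * w \<in> \<int>"
    then have "1 - 2 * w \<in> \<int>"
      by simp
    moreover have "1 - 2 * w = 2 * g - y - 1/2"
      unfolding w2 by simp
    ultimately show False
      using assms(2) by simp
  qed
  have s: "g + (y + 1/2) / 2 = z + 1/2" "1 - g + (y + 1/2) / 2 = w + 1/2"
    by (simp_all add: z_def w_def field_simps)
  have "gamma_quotient g y (1/2) = (Gamma z * Gamma (z + 1/2)) / (Gamma w * Gamma (w + 1/2))"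
    unfolding gamma_quotient_def s z_def[symmetric] w_def[symmetric]
    by (simp add: rGamma_inverse_Gamma field_simps)
  also have "\<dots> = (2 powr (1 - 2 * z) / 2 powr (1 - 2 * w)) * Gamma (2 * z) * rGamma (2 * w)"
    unfolding Gamma_mult_Gamma_half[OF \<open>2 * z \<notin> \<int>\<close>] Gamma_mult_Gamma_half[OF \<open>2 * w \<notin> \<int>\<close>]
    by (simp add: rGamma_inverse_Gamma field_simps)
  also have "2 powr (1 - 2 * z) / 2 powr (1 - 2 * w) = (2 powr (2 - 4 * g) :: complex)"
    unfolding z w2 powr_diff[symmetric] by (simp add: algebra_simps)
  finally show ?thesis
    unfolding z w2 .
qed

text \<open>Both sides obey the same recurrence from \<open>(N, y + 1)\<close> to
  \<open>(N + 1, y)\<close>, hence an induction on \<open>N\<close> with \<open>y\<close> free. The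
  Pochhammer symbols of length \<open>Suc k\<close> absorb the factor
  \<open>1 / ((1/2 - 2 g - y) (1/2 - 2 g + y))\<close> in front of the \<open>3F2\<close>, whose
  lower parameters are larger by one.\<close>

theorem whipple_terminating:
  fixes g y :: complex
  assumes "2 * g + y - 1/2 \<notin> \<int>" "2 * g - y - 1/2 \<notin> \<int>"
  shows "gamma_quotient g y (of_nat N + 1/2) =
     - (2 powr (2 - 4 * g) * Gamma (2 * g + y + 1/2) * rGamma (1/2 - 2 * g + y)) *
     (\<Sum>k\<le>N. pochhammer (- of_nat N) k * pochhammer (of_nat N + 1) k * pochhammer (1 - 2 * g) k /
        (fact k * pochhammer (1/2 - 2 * g - y) (Suc k) * pochhammer (1/2 - 2 * g + y) (Suc k)))"
  using assms
proof (induction N arbitrary: y)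
  case 0
  define P where "P = 1/2 - 2 * g"
  have P: "2 * g = 1/2 - P" by (simp add: P_def)
  have prems: "y - P \<notin> \<int>" "- (P + y) \<notin> \<int>"
    using "0.prems" by (simp_all add: P)
  then have nz: "P - y \<noteq> 0" "P + y \<noteq> 0"
    using Ints_minus[of "P - y"] Ints_minus[of "P + y"] by auto
  have 1: "Gamma (y - P + 1) = (y - P) * Gamma (y - P)"
    using prems nonpos_Ints_subset_Ints by (intro Gamma_plus1) auto
  have 2: "rGamma (P + y) = (P + y) * rGamma (P + y + 1)"
    by (simp add: rGamma_plus1)
  have "gamma_quotient g y (1/2) = 2 powr (2 - 4 * g) * Gamma (y - P) * rGamma (P + y + 1)"
    using gamma_quotient_half[OF "0.prems"] by (simp add: P add_ac)
  also have "\<dots> = - (2 powr (2 - 4 * g) * Gamma (y - P + 1) * rGamma (P + y)) / ((P - y) * (P + y))"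
    unfolding 1 2 using nz
    by (subst nonzero_eq_divide_eq) (simp, simp add: algebra_simps)
  also have "y - P + 1 = 2 * g + y + 1/2"
    unfolding P by simp
  finally show ?case
    by (simp add: P_def)
next
  case (Suc N)
  define P where "P = 1/2 - 2 * g"
  have P: "2 * g = 1/2 - P" by (simp add: P_def)
  define u where "u = (of_nat N + 1/2 :: complex)"
  define S where "S = (\<lambda>N y. \<Sum>k\<le>N. pochhammer (- of_nat N) k * pochhammer (of_nat N + 1) k * pochhammer (P + 1/2) k /
              (fact k * pochhammer (P - y) (Suc k) * pochhammer (P + y) (Suc k)))"
  have prems: "y - P \<notin> \<int>" "- (P + y) \<notin> \<int>"
    using Suc.prems by (simp_all add: P)
  have nI: "P + y \<notin> \<int>" "P - y \<notin> \<int>"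
    using prems Ints_minus[of "P - y"] Ints_minus[of "P + y"] by auto
  have SS: "(y - 1 - of_nat N - P) * (P + y) * S (Suc N) y = (y - of_nat N + P) * (y + 1 - P) * S N (y + 1)"
    unfolding S_def by (rule whipple_sum_Suc[OF nI])
  have 2: "2 * (g + (y - 1 - u) / 2) = y - 1 - of_nat N - P"
  proof -
    have "2 * (g + (y - 1 - u) / 2) = 2 * g + (y - 1 - u)"
      by (simp add: field_simps)
    then show ?thesis
      by (simp add: P u_def)
  qed
  have ni: "y - 1 - of_nat N - P \<notin> \<int>"
    by (rule not_Ints_translate[OF prems(1)]) simp
  have "g + (y - 1 - u) / 2 \<notin> \<int>\<^sub>\<le>\<^sub>0"
    using not_Ints_if_double_not_Ints[of "g + (y - 1 - u) / 2"] ni nonpos_Ints_subset_Ints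
    unfolding 2 by blast
  from gamma_quotient_rec[OF this]
  moreover have "y - 1 - u + 2 * g = y - 1 - of_nat N - P" "y + 1 - u - 2 * g = y - of_nat N + P"
      "u + 1 = of_nat (Suc N) + 1/2"
    by (simp_all add: P u_def)
  ultimately have GG: "(y - 1 - of_nat N - P) * gamma_quotient g y (of_nat (Suc N) + 1/2) =
        (y - of_nat N + P) * gamma_quotient g (y + 1) u"
    by (simp only:)
  have "2 * g + (y + 1) - 1/2 \<notin> \<int>" "2 * g - (y + 1) - 1/2 \<notin> \<int>"
    by (rule not_Ints_translate[OF Suc.prems(1)] not_Ints_translate[OF Suc.prems(2)]; simp; fail)+
  note IH = Suc.IH[OF this]
  have "2 * g + (y + 1) + 1/2 = y - P + 1 + 1" "1 - 2 * g = P + 1/2" "P + (y + 1) = P + y + 1"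
    by (simp_all add: P)
  with IH have IH: "gamma_quotient g (y + 1) u =
     - (2 powr (2 - 4 * g) * Gamma (y - P + 1 + 1) * rGamma (P + y + 1)) * S N (y + 1)"
    unfolding S_def u_def by (simp only: P_def[symmetric])
  have 3: "Gamma (y - P + 1 + 1) = (y - P + 1) * Gamma (y - P + 1)"
    using not_Ints_translate[OF prems(1), of "y - P + 1"] nonpos_Ints_subset_Ints by (intro Gamma_plus1) auto
  have 4: "rGamma (P + y) = (P + y) * rGamma (P + y + 1)"
    by (simp add: rGamma_plus1)
  have "(y - 1 - of_nat N - P) * gamma_quotient g y (of_nat (Suc N) + 1/2) =
     - (2 powr (2 - 4 * g) * Gamma (y - P + 1) * rGamma (P + y + 1)) *
     ((y - of_nat N + P) * (y + 1 - P) * S N (y + 1))"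
    unfolding GG IH 3 by (simp add: algebra_simps)
  also have "\<dots> = (y - 1 - of_nat N - P) * (- (2 powr (2 - 4 * g) * Gamma (y - P + 1) * rGamma (P + y)) * S (Suc N) y)"
    unfolding SS[symmetric] 4 by (simp add: algebra_simps)
  \<comment> \<open>The common factor \<open>y - 1 - of_nat N - P\<close> cancels, since it is not
    an integer and therefore not zero.\<close>
  finally have "gamma_quotient g y (of_nat (Suc N) + 1/2) =
     - (2 powr (2 - 4 * g) * Gamma (y - P + 1) * rGamma (P + y)) * S (Suc N) y"
    using ni by (metis Ints_0 mult_left_cancel)
  moreover have "y - P + 1 = 2 * g + y + 1/2"
    unfolding P by simp
  moreover have "P + 1/2 = 1 - 2 * g"
    by (simp add: P)
  ultimately show ?case
    unfolding S_def by (simp only: P_def)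
qed

subsection \<open>Divided differences\<close>

text \<open>The sum is the coefficient of degree \<open>card I - 1\<close> in the Lagrange
  interpolant \<open>q\<close> of \<open>p\<close> at the nodes. The interpolant is \<open>p\<close>
  itself, whose degree is smaller.\<close>

lemma divided_difference_eq_0:
  fixes x :: "'b \<Rightarrow> 'a::field" and p :: "'a poly"
  assumes "finite I" "inj_on x I" "degree p < card I - 1"
  shows "(\<Sum>i\<in>I. poly p (x i) / (\<Prod>j\<in>I - {i}. x i - x j)) = 0"
proof -
  define L where "L = (\<lambda>i. \<Prod>j\<in>I - {i}. [:- x j, 1:])"
  define D where "D = (\<lambda>i. \<Prod>j\<in>I - {i}. x i - x j)"
  define q where "q = (\<Sum>i\<in>I. smult (poly p (x i) / D i) (L i))"
  have degL: "degree (L i) = card I - 1" if "i \<in> I" for i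
    using that assms(1) by (simp add: L_def degree_prod_eq_sum_degree)
  have "lead_coeff (L i) = 1" for i
    unfolding L_def lead_coeff_prod by simp
  \<comment> \<open>Since every basis product is monic of the top degree, the top coefficient of
    \<open>q\<close> is the plain sum of the weights.\<close>
  with degL have monic: "coeff (L i) (card I - 1) = 1" if "i \<in> I" for i
    using that by metis
  have "poly p z = poly q z" if z: "z \<in> x ` I" for z
  proof -
    obtain j where j: "j \<in> I" "z = x j"
      using z by auto
    have D: "D j \<noteq> 0"
      using assms j by (auto simp: D_def inj_on_def)
    have "poly q z = (\<Sum>i\<in>I. if i = j then poly p z else 0)"
      unfolding q_def poly_sum
    proof (rule sum.cong)
      fix i assume i: "i \<in> I"
      have "poly (L i) z = (\<Prod>k\<in>I - {i}. x j - x k)"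
        by (simp add: L_def poly_prod j)
      also have "\<dots> = (if i = j then D j else 0)"
        using assms i j by (auto simp: D_def)
      finally show "poly (smult (poly p (x i) / D i) (L i)) z = (if i = j then poly p z else 0)"
        using D j by simp
    qed simp
    then show ?thesis
      using assms(1) j by simp
  qed
  moreover have "degree q < card (x ` I)"
  proof -
    have "degree q \<le> card I - 1"
      unfolding q_def using assms(1) degL by (intro degree_sum_le) (auto intro: order.trans[OF degree_smult_le])
    then show ?thesis
      using assms by (simp add: card_image)
  qed
  ultimately have "p = q"
    using assms by (intro poly_eqI_degree[of "x ` I"]) (auto simp: card_image)
  then have "coeff p (card I - 1) = coeff q (card I - 1)"
    by simp
  also have "\<dots> = (\<Sum>i\<in>I. poly p (x i) / D i * coeff (L i) (card I - 1))"
    by (simp add: q_def coeff_sum)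
  also have "\<dots> = (\<Sum>i\<in>I. poly p (x i) / D i)"
    using monic by (intro sum.cong) auto
  finally show ?thesis
    using coeff_eq_0[OF assms(3)] by (simp add: D_def)
qed

text \<open>Each difference factors as \<open>(N - j) (N + j + 1)\<close>. The first factors give
  \<open>N!\<close> and a signed \<open>(n - N)!\<close>, the second ones
  \<open>(n + N + 1)! / N!\<close> without the factor \<open>2 N + 1\<close> that belongs to
  \<open>j = N\<close>.\<close>

lemma prod_diff_half_squares:
  fixes N n :: nat
  assumes "N \<le> n"
  shows "(\<Prod>j\<in>{..n} - {N}. (of_nat N + 1/2)\<^sup>2 - (of_nat j + 1/2)\<^sup>2 :: 'a::field_char_0)
     = (-1) ^ (n - N) * fact (n - N) * fact (n + N + 1) / (2 * of_nat N + 1)"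
proof -
  have fac: "(of_nat N + 1/2)\<^sup>2 - (of_nat j + 1/2)\<^sup>2 = (of_nat N - of_nat j) * (of_nat N + of_nat j + 1 :: 'a)" for j
    by (simp add: power2_eq_square field_simps)
  show ?thesis
    using assms
  \<comment> \<open>The induction starts at \<open>n = N\<close>, where all differences have the
    same sign; each further node contributes one negative factor.\<close>
  proof (induction n rule: dec_induct)
    case base
    have "(\<Prod>j\<in>{..N} - {N}. (of_nat N + 1/2)\<^sup>2 - (of_nat j + 1/2)\<^sup>2 :: 'a)
        = (\<Prod>j<N. of_nat ((N - j) * (N + j + 1)))"
    proof (intro prod.cong)
      fix j assume "j \<in> {..<N}"
      then have "of_nat (N - j) = (of_nat N - of_nat j :: 'a)"
        by (simp add: of_nat_diff)
      then show "(of_nat N + 1/2)\<^sup>2 - (of_nat j + 1/2)\<^sup>2 = (of_nat ((N - j) * (N + j + 1)) :: 'a)"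
        unfolding fac by (simp only: of_nat_mult of_nat_add of_nat_1)
    qed auto
    also have "\<dots> = of_nat ((\<Prod>j<N. N - j) * (\<Prod>j<N. N + j + 1))"
      by (simp only: of_nat_prod[symmetric] prod.distrib)
    also have "(\<Prod>j<N. N - j) = fact N"
      by (simp add: fact_prod_rev atLeast0LessThan)
    also have "fact N * (\<Prod>j<N. N + j + 1) = (fact (2 * N) :: nat)"
    proof -
      have "(\<Prod>j<N. N + j + 1) = pochhammer (Suc N) N"
        by (simp add: pochhammer_prod atLeast0LessThan)
      then show ?thesis
        using pochhammer_product'[of "1::nat" N N] by (simp add: pochhammer_fact mult_2)
    qed
    also have "of_nat (fact (2 * N)) = (fact (N + N + 1) / (2 * of_nat N + 1) :: 'a)"
    proof -
      have "2 * of_nat N + 1 = (of_nat (Suc (2 * N)) :: 'a)"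
        by simp
      then show ?thesis
        by (simp only: mult_2[symmetric] Suc_eq_plus1[symmetric] fact_Suc of_nat_fact)
          (simp del: of_nat_Suc)
    qed
    finally show ?case
      by simp
  next
    case (step n)
    define d where "d = n - N"
    have n: "n = N + d"
      using step.hyps by (simp add: d_def)
    have "{..Suc n} - {N} = insert (Suc n) ({..n} - {N})"
      using step.hyps by auto
    then have "(\<Prod>j\<in>{..Suc n} - {N}. (of_nat N + 1/2)\<^sup>2 - (of_nat j + 1/2)\<^sup>2 :: 'a)
        = ((of_nat N + 1/2)\<^sup>2 - (of_nat (Suc n) + 1/2)\<^sup>2) *
          ((-1) ^ (n - N) * fact (n - N) * fact (n + N + 1) / (2 * of_nat N + 1))"
      by (subst step.IH[symmetric]) simp
    also have "\<dots> = (- of_nat (Suc d)) * of_nat (2 * N + d + 2) * ((-1) ^ d * fact d * fact (2 * N + d + 1) / (2 * of_nat N + 1))"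
    proof -
      have "of_nat N - of_nat (Suc n) = (- of_nat (Suc d) :: 'a)"
        "of_nat N + of_nat (Suc n) + 1 = (of_nat (2 * N + d + 2) :: 'a)"
        by (simp_all add: n)
      moreover have "n - N = d" "n + N + 1 = 2 * N + d + 1"
        by (simp_all add: n)
      ultimately show ?thesis
        unfolding fac by (simp only:)
    qed
    also have "\<dots> = (-1) ^ Suc d * (of_nat (Suc d) * fact d) * (of_nat (2 * N + d + 2) * fact (2 * N + d + 1)) / (2 * of_nat N + 1)"
      by (simp add: mult_ac del: of_nat_Suc of_nat_add of_nat_mult)
    also have "of_nat (Suc d) * fact d = (fact (Suc n - N) :: 'a)"
      by (simp add: n)
    also have "of_nat (2 * N + d + 2) * fact (2 * N + d + 1) = (fact (Suc n + N + 1) :: 'a)"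
    proof -
      have "Suc n + N + 1 = Suc (2 * N + d + 1)" "2 * N + d + 2 = Suc (2 * N + d + 1)"
        by (simp_all add: n)
      then show ?thesis
        by (simp only: fact_Suc)
    qed
    finally show ?case
      by (simp add: n)
  qed
qed

subsection \<open>The double sum\<close>

text \<open>Moves the shift \<open>j\<close> from the denominator into a product in the numerator,
  so that terms with different \<open>j\<close> get a common denominator. The core is that
  \<open>pochhammer (w - j) (j + k + 1)\<close> can be split after \<open>j\<close> or after
  \<open>k + 1\<close> factors.\<close>

lemma Gamma_shift_over_pochhammer:
  fixes w :: complex
  assumes "w \<notin> \<int>"
  shows "Gamma (1 - w + of_nat j) / pochhammer (w - of_nat j) (Suc k)
       = Gamma (1 - w) * ((-1) ^ j * pochhammer (w + of_nat k + 1 - of_nat j) j) / pochhammer w (Suc k)"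
proof -
  have "1 - w \<notin> \<int>"
    using assms Ints_diff[of 1 "1 - w"] by auto
  then have "1 - w \<notin> \<int>\<^sub>\<le>\<^sub>0" "Gamma (1 - w) \<noteq> 0"
    using nonpos_Ints_subset_Ints by (auto simp: Gamma_eq_zero_iff)
  then have "Gamma (1 - w + of_nat j) = Gamma (1 - w) * pochhammer (1 - w) j"
    by (simp add: pochhammer_Gamma)
  also have "pochhammer (1 - w) j = (-1) ^ j * pochhammer (w - of_nat j) j"
    using pochhammer_minus[of "w - 1" j] by simp
  finally have 1: "Gamma (1 - w + of_nat j) = Gamma (1 - w) * ((-1) ^ j * pochhammer (w - of_nat j) j)" .
  have 2: "pochhammer (w - of_nat j) j * pochhammer w (Suc k) =
        pochhammer (w - of_nat j) (Suc k) * pochhammer (w + of_nat k + 1 - of_nat j) j"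
  proof -
    have "w - of_nat j + of_nat (Suc k) = w + of_nat k + 1 - of_nat j"
      by simp
    then show ?thesis
      using pochhammer_product'[of "w - of_nat j" j "Suc k"] pochhammer_product'[of "w - of_nat j" "Suc k" j]
      by (simp only: add.commute[of j] diff_add_cancel)
  qed
  have nz: "pochhammer w (Suc k) \<noteq> 0" "pochhammer (w - of_nat j) (Suc k) \<noteq> 0"
    by (rule pochhammer_translate_nonzero[OF assms]; simp)+
  show ?thesis
    unfolding frac_eq_eq[OF nz(2,1)] 1 mult.assoc 2 by (simp only: mult_ac)
qed

text \<open>The companion for the reciprocal Gamma factor, by the same two splittings; here no sign
  arises.\<close>

lemma rGamma_shift_over_pochhammer:
  fixes z :: complex
  assumes "z \<notin> \<int>"
  shows "rGamma (z - of_nat i) / pochhammer (z - of_nat i) (Suc k)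
       = rGamma z * pochhammer (z + of_nat k + 1 - of_nat i) i / pochhammer z (Suc k)"
proof -
  have 1: "rGamma (z - of_nat i) = rGamma z * pochhammer (z - of_nat i) i"
    using pochhammer_rGamma[of "z - of_nat i" i] by simp
  have 2: "pochhammer (z - of_nat i) i * pochhammer z (Suc k) =
        pochhammer (z - of_nat i) (Suc k) * pochhammer (z + of_nat k + 1 - of_nat i) i"
  proof -
    have "z - of_nat i + of_nat (Suc k) = z + of_nat k + 1 - of_nat i"
      by simp
    then show ?thesis
      using pochhammer_product'[of "z - of_nat i" i "Suc k"] pochhammer_product'[of "z - of_nat i" "Suc k" i]
      by (simp only: add.commute[of i] diff_add_cancel)
  qed
  have nz: "pochhammer z (Suc k) \<noteq> 0" "pochhammer (z - of_nat i) (Suc k) \<noteq> 0"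
    by (rule pochhammer_translate_nonzero[OF assms]; simp)+
  show ?thesis
    unfolding frac_eq_eq[OF nz(2,1)] 1 mult.assoc 2 by (simp only: mult_ac)
qed

lemma pochhammer_reflect: "pochhammer (x :: complex) k = (-1) ^ k * pochhammer (1 - x - of_nat k) k"
  using pochhammer_minus[of "- x" k] by (simp add: algebra_simps)

text \<open>With \<open>A = - m - 2 v\<close> and \<open>b = - X - v\<close> the sum is a constant
  multiple of the very well poised one. The right side is free of \<open>v\<close>: this is what
  later makes the coefficients of the expansion independent of the outer summation index.\<close>

lemma falling_product_sum:
  fixes X v :: complex
  assumes "2 * v \<notin> \<int>" "X - v \<notin> \<int>"
  shows "pochhammer (v + (1 - of_nat m) / 2) m *
     (\<Sum>i\<le>m. pochhammer (- of_nat m) i / fact i * ((v + of_nat m / 2 - of_nat i) / pochhammer (2 * v - of_nat i) (Suc m)) *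
        ((-1) ^ (m - i) * pochhammer (X - v + 1 - of_nat (m - i)) (m - i) * pochhammer (X + v + 1 - of_nat i) i))
     = (-1) ^ m / 2 * pochhammer (X + (1 - of_nat m) / 2) m"
proof -
  define A b where "A = - of_nat m - 2 * v" and "b = - X - v"
  have Ab: "A \<notin> \<int>" "A - b \<notin> \<int>"
  proof -
    have "- (2 * v) \<notin> \<int>"
      using assms(1) Ints_minus[of "- (2 * v)"] by auto
    then show "A \<notin> \<int>"
      by (rule not_Ints_translate) (simp add: A_def)
    show "A - b \<notin> \<int>"
      by (rule not_Ints_translate[OF assms(2)]) (simp add: A_def b_def)
  qed
  define t where "t = (\<lambda>i. (A + 2 * of_nat i) * (pochhammer A i * pochhammer b i * pochhammer (- of_nat m) i /
             (fact i * pochhammer (1 + A - b) i * pochhammer (1 + A + of_nat m) i)))"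
  have summand: "pochhammer (- of_nat m) i / fact i * ((v + of_nat m / 2 - of_nat i) / pochhammer (2 * v - of_nat i) (Suc m)) *
        ((-1) ^ (m - i) * pochhammer (X - v + 1 - of_nat (m - i)) (m - i) * pochhammer (X + v + 1 - of_nat i) i)
     = pochhammer (1 + A - b) m / (2 * pochhammer A (Suc m)) * t i" if "i \<le> m" for i
  proof -
    have nz: "pochhammer A i \<noteq> 0" "pochhammer A (Suc m) \<noteq> 0" "pochhammer (1 + A + of_nat m) i \<noteq> 0"
       "pochhammer (1 + A - b) i \<noteq> 0" "pochhammer (A + of_nat i) (Suc m) \<noteq> 0"
      by (rule pochhammer_translate_nonzero[OF Ab(1)] pochhammer_translate_nonzero[OF Ab(2)]; simp; fail)+
    \<comment> \<open>This linear factor becomes the very well poised factor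
      \<open>A + 2 i\<close>.\<close>
    have 1: "v + of_nat m / 2 - of_nat i = - (A + 2 * of_nat i) / 2"
      by (simp add: A_def field_simps)
    have "pochhammer (2 * v - of_nat i) (Suc m) = (-1) ^ Suc m * pochhammer (A + of_nat i) (Suc m)"
    proof -
      have "1 - (2 * v - of_nat i) - of_nat (Suc m) = A + of_nat i"
        by (simp add: A_def)
      then show ?thesis
        using pochhammer_reflect[of "2 * v - of_nat i" "Suc m"] by (simp only:)
    qed
    \<comment> \<open>Both sides equal \<open>pochhammer A (i + m + 1)\<close>.\<close>
    moreover have "pochhammer A i * pochhammer (A + of_nat i) (Suc m) = pochhammer A (Suc m) * pochhammer (1 + A + of_nat m) i"
      using pochhammer_product'[of A i "Suc m"] pochhammer_product'[of A "Suc m" i]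
      by (simp add: add_ac del: pochhammer_Suc)
    ultimately have 2: "pochhammer (2 * v - of_nat i) (Suc m) =
        (-1) ^ Suc m * (pochhammer A (Suc m) * pochhammer (1 + A + of_nat m) i / pochhammer A i)"
      using nz by (simp add: field_simps del: pochhammer_Suc power_Suc)
    have 3: "pochhammer (X + v + 1 - of_nat i) i = (-1) ^ i * pochhammer b i"
    proof -
      have "1 - (X + v + 1 - of_nat i) - of_nat i = b"
        by (simp add: b_def)
      then show ?thesis
        using pochhammer_reflect[of "X + v + 1 - of_nat i" i] by (simp only:)
    qed
    have "1 + A - b + of_nat i = X - v + 1 - of_nat (m - i)"
      using that by (simp add: A_def b_def of_nat_diff)
    then have "pochhammer (1 + A - b) m
        = pochhammer (1 + A - b) i * pochhammer (X - v + 1 - of_nat (m - i)) (m - i)"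
      using pochhammer_product'[of "1 + A - b" i "m - i"] that by (simp only: le_add_diff_inverse)
    then have 4: "pochhammer (X - v + 1 - of_nat (m - i)) (m - i) = pochhammer (1 + A - b) m / pochhammer (1 + A - b) i"
      using nz(4) by (simp add: nonzero_eq_divide_eq mult.commute)
    have 5: "(-1) ^ (m - i) * ((-1) ^ i) = ((-1) ^ m :: complex)"
      using that by (simp add: power_add[symmetric])
    define s where "s = ((-1) ^ m :: complex)"
    have s: "s * s = 1" "s \<noteq> 0"
      by (simp_all add: s_def power_mult_distrib[symmetric])
    have "pochhammer (- of_nat m) i / fact i * ((v + of_nat m / 2 - of_nat i) / pochhammer (2 * v - of_nat i) (Suc m)) *
        ((-1) ^ (m - i) * pochhammer (X - v + 1 - of_nat (m - i)) (m - i) * pochhammer (X + v + 1 - of_nat i) i)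
      = pochhammer (- of_nat m) i / fact i * (- (A + 2 * of_nat i) / 2 / (- s * (pochhammer A (Suc m) * pochhammer (1 + A + of_nat m) i / pochhammer A i))) *
        (((-1) ^ (m - i) * (-1) ^ i) * (pochhammer (1 + A - b) m / pochhammer (1 + A - b) i * pochhammer b i))"
      unfolding 1 2 3 4 s_def by (simp only: power_Suc mult_minus1 mult_ac)
    also have "\<dots> = pochhammer (1 + A - b) m / (2 * pochhammer A (Suc m)) * t i"
      unfolding 5 s_def[symmetric] t_def using nz s(2)
      by (simp add: divide_simps del: pochhammer_Suc) (simp add: algebra_simps del: pochhammer_Suc)
    finally show ?thesis .
  qed
  have nz: "pochhammer A (Suc m) \<noteq> 0" "pochhammer (1 + A - b) m \<noteq> 0"
    by (rule pochhammer_translate_nonzero[OF Ab(1)] pochhammer_translate_nonzero[OF Ab(2)]; simp; fail)+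
  have nz': "pochhammer ((1 + A) / 2) m \<noteq> 0"
  proof -
    have "2 * ((1 + A) / 2) = 1 + A"
      by (simp add: field_simps)
    then have "2 * ((1 + A) / 2) \<notin> \<int>"
      using not_Ints_translate[OF Ab(1), of "1 + A"] by (simp only:) simp
    then have "(1 + A) / 2 \<notin> \<int>"
      by (rule not_Ints_if_double_not_Ints)
    then show ?thesis
      by (rule pochhammer_translate_nonzero) simp
  qed
  \<comment> \<open>Up to sign, the prefactor is the denominator
    \<open>pochhammer ((1 + A) / 2) m\<close> of the closed form and cancels it.\<close>
  have 1: "pochhammer (v + (1 - of_nat m) / 2) m = (-1) ^ m * pochhammer ((1 + A) / 2) m"
  proof -
    have "1 - (v + (1 - of_nat m) / 2) - of_nat m = (1 + A) / 2"
      by (simp add: A_def field_simps)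
    then show ?thesis
      using pochhammer_reflect[of "v + (1 - of_nat m) / 2" m] by (simp only:)
  qed
  have 2: "(1 + A) / 2 - b = X + (1 - of_nat m) / 2"
    by (simp add: A_def b_def field_simps)
  have 3: "(\<Sum>i\<le>m. t i) = pochhammer A (Suc m) * pochhammer ((1 + A) / 2 - b) m /
        (pochhammer (1 + A - b) m * pochhammer ((1 + A) / 2) m)"
    unfolding t_def very_well_poised_sum[OF Ab] by (simp add: pochhammer_rec add.commute)
  have 4: "(\<Sum>i\<le>m. pochhammer (- of_nat m) i / fact i * ((v + of_nat m / 2 - of_nat i) / pochhammer (2 * v - of_nat i) (Suc m)) *
        ((-1) ^ (m - i) * pochhammer (X - v + 1 - of_nat (m - i)) (m - i) * pochhammer (X + v + 1 - of_nat i) i))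
    = pochhammer (1 + A - b) m / (2 * pochhammer A (Suc m)) * (\<Sum>i\<le>m. t i)"
    unfolding sum_distrib_left by (intro sum.cong) (simp_all only: summand atMost_iff)
  show ?thesis
    unfolding 4 3 1 2 using nz nz' by (simp del: pochhammer_Suc)
qed

text \<open>Whipple's sum expands the quotient for each \<open>i\<close>; the shift lemmas give all
  these expansions the same denominators, and after the interchange the inner sum over
  \<open>i\<close> is \<open>falling_product_sum\<close>. Its value merges with
  \<open>pochhammer e k\<close> into the symbol of length \<open>k + m\<close>.\<close>

lemma gamma_quotient_sum:
  fixes \<beta> v :: complex
  assumes "2 * v \<notin> \<int>" "\<beta> + v - 1/2 \<notin> \<int>" "\<beta> - v - 1/2 \<notin> \<int>"
  shows "pochhammer (v + (1 - of_nat m) / 2) m *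
     (\<Sum>i\<le>m. pochhammer (- of_nat m) i / fact i * ((v + of_nat m / 2 - of_nat i) / pochhammer (2 * v - of_nat i) (Suc m)) *
        gamma_quotient (\<beta> / 2 + of_nat m / 4) (v + of_nat m / 2 - of_nat i) (of_nat N + 1/2))
    = - ((-1) ^ m * 2 powr (1 - 2 * \<beta> - of_nat m)) * (Gamma (1/2 + \<beta> + v) * rGamma (1/2 - \<beta> + v)) *
      (\<Sum>k\<le>N. pochhammer (- of_nat N) k * pochhammer (of_nat N + 1) k * pochhammer (1 - \<beta> - of_nat m / 2) (k + m) /
        (fact k * pochhammer (1/2 - \<beta> - v) (Suc k) * pochhammer (1/2 - \<beta> + v) (Suc k)))"
proof -
  define z w where "z = 1/2 - \<beta> + v" and "w = 1/2 - \<beta> - v"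
  define e where "e = 1 - \<beta> - of_nat m / 2"
  define c where "c = (\<lambda>k. pochhammer (- of_nat N) k * pochhammer (of_nat N + 1) k * pochhammer e k / fact k :: complex)"
  define a where "a = (\<lambda>i. pochhammer (- of_nat m) i / fact i * ((v + of_nat m / 2 - of_nat i) / pochhammer (2 * v - of_nat i) (Suc m)))"
  define p where "p = (\<lambda>i k. (-1) ^ (m - i) * pochhammer (w + of_nat k + 1 - of_nat (m - i)) (m - i) *
     pochhammer (z + of_nat k + 1 - of_nat i) i)"
  have w: "w \<notin> \<int>"
    using assms(2) Ints_minus[of w] by (auto simp: w_def algebra_simps)
  have z: "z \<notin> \<int>"
    using assms(3) Ints_minus[of z] by (auto simp: z_def algebra_simps)
  have G: "gamma_quotient (\<beta> / 2 + of_nat m / 4) (v + of_nat m / 2 - of_nat i) (of_nat N + 1/2)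
     = - (2 powr (2 - 2 * \<beta> - of_nat m) * Gamma (1 - w) * rGamma z) *
       (\<Sum>k\<le>N. c k / (pochhammer w (Suc k) * pochhammer z (Suc k)) * p i k)"
    if "i \<le> m" for i
  proof -
    define g y where "g = \<beta> / 2 + of_nat m / 4" and "y = v + of_nat m / 2 - of_nat i"
    have mi: "of_nat (m - i) = (of_nat m - of_nat i :: complex)"
      using that by (simp add: of_nat_diff)
    have g2: "2 * g = \<beta> + of_nat m / 2"
      by (simp add: g_def)
    have eqs: "2 * g + y + 1/2 = 1 - w + of_nat (m - i)" "1/2 - 2 * g - y = w - of_nat (m - i)"
      "1/2 - 2 * g + y = z - of_nat i" "1 - 2 * g = e" "2 - 4 * g = 2 - 2 * \<beta> - of_nat m"
      unfolding mi by (simp_all add: g2 y_def w_def z_def e_def g_def field_simps)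
    have "2 * g + y - 1/2 \<notin> \<int>"
      by (rule not_Ints_translate[OF assms(2)]) (simp add: g2 y_def)
    moreover have "2 * g - y - 1/2 \<notin> \<int>"
      by (rule not_Ints_translate[OF assms(3)]) (simp add: g2 y_def)
    ultimately have "gamma_quotient g y (of_nat N + 1/2) =
       - (2 powr (2 - 4 * g) * Gamma (2 * g + y + 1/2) * rGamma (1/2 - 2 * g + y)) *
       (\<Sum>k\<le>N. pochhammer (- of_nat N) k * pochhammer (of_nat N + 1) k * pochhammer (1 - 2 * g) k /
         (fact k * pochhammer (1/2 - 2 * g - y) (Suc k) * pochhammer (1/2 - 2 * g + y) (Suc k)))"
      by (rule whipple_terminating)
    also have "\<dots> = - (2 powr (2 - 2 * \<beta> - of_nat m)) *
       (\<Sum>k\<le>N. c k * (Gamma (1 - w + of_nat (m - i)) / pochhammer (w - of_nat (m - i)) (Suc k)) *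
         (rGamma (z - of_nat i) / pochhammer (z - of_nat i) (Suc k)))"
      unfolding eqs sum_distrib_left c_def
      by (intro sum.cong refl) (simp del: pochhammer_Suc add: mult_ac)
    also have "\<dots> = - (2 powr (2 - 2 * \<beta> - of_nat m) * Gamma (1 - w) * rGamma z) *
       (\<Sum>k\<le>N. c k / (pochhammer w (Suc k) * pochhammer z (Suc k)) * p i k)"
      unfolding Gamma_shift_over_pochhammer[OF w] rGamma_shift_over_pochhammer[OF z] sum_distrib_left p_def
      by (intro sum.cong refl) (simp del: pochhammer_Suc add: mult_ac)
    finally show ?thesis
      by (simp only: g_def y_def)
  qed
  have P: "pochhammer (v + (1 - of_nat m) / 2) m * (\<Sum>i\<le>m. a i * p i k)
      = (-1) ^ m / 2 * pochhammer (e + of_nat k) m" for k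
  proof -
    \<comment> \<open>Chosen as the mean of \<open>w + k\<close> and \<open>z + k\<close>, which are
      then \<open>X - v\<close> and \<open>X + v\<close>.\<close>
    define X where "X = 1/2 - \<beta> + of_nat k"
    have eqs: "w + of_nat k = X - v" "z + of_nat k = X + v" "e + of_nat k = X + (1 - of_nat m) / 2"
      by (simp_all add: X_def w_def z_def e_def field_simps)
    have "X - v \<notin> \<int>"
      by (rule not_Ints_translate[OF w]) (simp add: X_def w_def)
    from falling_product_sum[OF assms(1) this, of m] show ?thesis
      unfolding a_def p_def eqs .
  qed
  define K where "K = - (2 powr (2 - 2 * \<beta> - of_nat m) * Gamma (1 - w) * rGamma z)"
  have "(\<Sum>i\<le>m. a i * gamma_quotient (\<beta> / 2 + of_nat m / 4) (v + of_nat m / 2 - of_nat i) (of_nat N + 1/2))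
     = (\<Sum>i\<le>m. \<Sum>k\<le>N. K * (c k / (pochhammer w (Suc k) * pochhammer z (Suc k))) * (a i * p i k))"
    by (intro sum.cong refl) (simp add: G[folded K_def] sum_distrib_left mult_ac del: pochhammer_Suc)
  also have "\<dots> = (\<Sum>k\<le>N. K * (c k / (pochhammer w (Suc k) * pochhammer z (Suc k))) * (\<Sum>i\<le>m. a i * p i k))"
    by (subst sum.swap) (simp only: sum_distrib_left)
  finally have "pochhammer (v + (1 - of_nat m) / 2) m *
      (\<Sum>i\<le>m. a i * gamma_quotient (\<beta> / 2 + of_nat m / 4) (v + of_nat m / 2 - of_nat i) (of_nat N + 1/2))
    = (\<Sum>k\<le>N. K * (c k / (pochhammer w (Suc k) * pochhammer z (Suc k))) *
         (pochhammer (v + (1 - of_nat m) / 2) m * (\<Sum>i\<le>m. a i * p i k)))"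
    by (simp only: sum_distrib_left mult.left_commute)
  also have "\<dots> = K * ((-1) ^ m / 2) * (\<Sum>k\<le>N. pochhammer (- of_nat N) k * pochhammer (of_nat N + 1) k * pochhammer e (k + m) /
        (fact k * pochhammer w (Suc k) * pochhammer z (Suc k)))"
    unfolding P
    unfolding pochhammer_product'[of e] sum_distrib_left c_def
    by (intro sum.cong refl) (simp del: pochhammer_Suc add: mult_ac)
  also have "K * ((-1) ^ m / 2) = - ((-1) ^ m * 2 powr (1 - 2 * \<beta> - of_nat m)) * (Gamma (1/2 + \<beta> + v) * rGamma z)"
  proof -
    have "2 - 2 * \<beta> - of_nat m = (1 - 2 * \<beta> - of_nat m) + 1"
      by simp
    then have "2 powr (2 - 2 * \<beta> - of_nat m) = 2 * 2 powr (1 - 2 * \<beta> - of_nat m)"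
      by (simp only: powr_add) simp
    moreover have "1 - w = 1/2 + \<beta> + v"
      by (simp add: w_def)
    ultimately show ?thesis
      by (simp add: K_def)
  qed
  finally show ?thesis
    unfolding a_def z_def w_def e_def .
qed

text \<open>As functions of \<open>x N\<close>, the square of \<open>N + 1/2\<close>, the two
  Pochhammer symbols form a polynomial of degree \<open>k\<close>, and the quotient of products one
  of degree at most \<open>n - k - 1\<close>. Together the degree is below \<open>n\<close>, so the
  divided difference over the \<open>n + 1\<close> nodes vanishes.\<close>

lemma nodal_sum_eq_0:
  fixes \<beta> c :: complex
  assumes "k < n" and nz: "\<And>N j. N \<le> n \<Longrightarrow> (1/2 - \<beta> + of_nat j)\<^sup>2 \<noteq> (c * (of_nat N + 1/2))\<^sup>2"
  shows "(\<Sum>N\<le>n. (-1) ^ N * (of_nat N + 1/2) / (fact (n - N) * fact (n + N + 1)) *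
     (pochhammer (- of_nat N) k * pochhammer (of_nat N + 1) k) *
     ((\<Prod>j<n. (1/2 - \<beta> + of_nat j)\<^sup>2 - (c * (of_nat N + 1/2))\<^sup>2) /
      (\<Prod>j<Suc k. (1/2 - \<beta> + of_nat j)\<^sup>2 - (c * (of_nat N + 1/2))\<^sup>2))) = 0"
proof -
  define x where "x = (\<lambda>N. (of_nat N + 1/2 :: complex)\<^sup>2)"
  define p where "p = (\<Prod>j<k. [:(of_nat j + 1/2)\<^sup>2, - 1:]) * (\<Prod>j\<in>{Suc k..<n}. [:(1/2 - \<beta> + of_nat j)\<^sup>2, - (c\<^sup>2):])"
  have inj: "inj_on x {..n}"
  proof (rule inj_onI)
    fix a b assume "x a = x b"
    then have "of_nat a + 1/2 = (of_nat b + 1/2 :: complex) \<or> of_nat a + 1/2 = - (of_nat b + 1/2 :: complex)"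
      by (simp add: x_def power2_eq_iff)
    moreover have "of_nat a + 1/2 \<noteq> - (of_nat b + 1/2 :: complex)"
    proof
      assume "of_nat a + 1/2 = - (of_nat b + 1/2 :: complex)"
      then have "of_nat (a + b + 1) = (0 :: complex)"
        by (simp add: eq_neg_iff_add_eq_0 add_ac)
      then show False
        by (simp only: of_nat_eq_0_iff)
    qed
    ultimately show "a = b"
      by simp
  qed
  have "degree p \<le> (\<Sum>j<k. degree [:(of_nat j + 1/2)\<^sup>2, - 1 :: complex:]) +
      (\<Sum>j\<in>{Suc k..<n}. degree [:(1/2 - \<beta> + of_nat j)\<^sup>2, - (c\<^sup>2):])"
    unfolding p_def by (intro order.trans[OF degree_mult_le] add_mono degree_prod_sum_le[unfolded o_def]) auto
  also have "\<dots> \<le> (\<Sum>j<k. 1) + (\<Sum>j\<in>{Suc k..<n}. 1)"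
    by (intro add_mono sum_mono) auto
  also have "\<dots> < card {..n} - 1"
    using assms(1) by simp
  finally have zero: "(\<Sum>N\<le>n. poly p (x N) / (\<Prod>j\<in>{..n} - {N}. x N - x j)) = 0"
    by (intro divided_difference_eq_0 inj) auto
  have summand: "(-1) ^ N * (of_nat N + 1/2) / (fact (n - N) * fact (n + N + 1)) *
     (pochhammer (- of_nat N) k * pochhammer (of_nat N + 1) k) *
     ((\<Prod>j<n. (1/2 - \<beta> + of_nat j)\<^sup>2 - (c * (of_nat N + 1/2))\<^sup>2) /
      (\<Prod>j<Suc k. (1/2 - \<beta> + of_nat j)\<^sup>2 - (c * (of_nat N + 1/2))\<^sup>2))
    = (-1) ^ n / 2 * (poly p (x N) / (\<Prod>j\<in>{..n} - {N}. x N - x j))" if "N \<le> n" for N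
  proof -
    define q where "q = (\<lambda>j. (1/2 - \<beta> + of_nat j)\<^sup>2 - (c * (of_nat N + 1/2))\<^sup>2)"
    have "pochhammer (- of_nat N) k * pochhammer (of_nat N + 1) k = (\<Prod>j<k. (of_nat j + 1/2)\<^sup>2 - x N)"
      unfolding pochhammer_prod atLeast0LessThan prod.distrib[symmetric]
      by (intro prod.cong) (auto simp: x_def power2_eq_square field_simps)
    moreover have "(\<Prod>j<n. q j) / (\<Prod>j<Suc k. q j) = (\<Prod>j\<in>{Suc k..<n}. q j)"
    proof -
      have "(\<Prod>j<n. q j) = (\<Prod>j<Suc k. q j) * (\<Prod>j\<in>{Suc k..<n}. q j)"
        using assms(1) prod.atLeastLessThan_concat[of 0 "Suc k" n q] by (simp only: atLeast0LessThan le_add1 Suc_leI le0)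
      moreover have "(\<Prod>j<Suc k. q j) \<noteq> 0"
        using nz[OF that] by (simp add: q_def del: prod.lessThan_Suc)
      ultimately show ?thesis
        by simp
    qed
    ultimately have p: "poly p (x N) = (pochhammer (- of_nat N) k * pochhammer (of_nat N + 1) k) *
        ((\<Prod>j<n. q j) / (\<Prod>j<Suc k. q j))"
    proof (simp only:)
      have "q j = (1/2 - \<beta> + of_nat j)\<^sup>2 - c\<^sup>2 * x N" for j
        by (simp add: q_def x_def power_mult_distrib)
      then show "poly p (x N) = (\<Prod>j<k. (of_nat j + 1/2)\<^sup>2 - x N) * (\<Prod>j\<in>{Suc k..<n}. q j)"
        by (simp add: p_def poly_prod mult.commute)
    qed
    have "(-1) ^ (n - N) = (-1 :: complex) ^ n * (-1) ^ N"
      using that by (auto simp: uminus_power_if)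
    then have d: "(\<Prod>j\<in>{..n} - {N}. x N - x j) = (-1) ^ n * (-1) ^ N * fact (n - N) * fact (n + N + 1) / (2 * of_nat N + 1)"
      using prod_diff_half_squares[OF that, where 'a = complex] by (simp only: x_def)
    define s t where "s = ((-1) ^ n :: complex)" and "t = ((-1) ^ N :: complex)"
    have st: "s * s = 1" "t * t = 1" "s \<noteq> 0" "t \<noteq> 0"
      by (simp_all add: s_def t_def power_mult_distrib[symmetric])
    define D where "D = (fact (n - N) * fact (n + N + 1) :: complex)"
    \<comment> \<open>The given weight is \<open>(-1)^n / 2\<close> times the divided difference
      weight at \<open>x N\<close>.\<close>
    have "t * (of_nat N + 1/2) / D = s / 2 / (s * t * D / (2 * of_nat N + 1))"
    proof -
      define h where "h = (2 * of_nat N + 1 :: complex)"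
      have "s / 2 / (s * t * D / h) = (1 / t) * (h / 2) / D"
        using st(3) by simp
      also have "1 / t = t"
        using st(2,4) by (simp add: nonzero_divide_eq_eq)
      also have "h / 2 = of_nat N + 1/2"
        by (simp add: h_def add_divide_distrib)
      finally show ?thesis
        by (simp only: h_def)
    qed
    then show ?thesis
      unfolding p q_def[symmetric] d s_def[symmetric] t_def[symmetric] mult.assoc[of _ "fact (n - N)"] D_def[symmetric]
      by (simp add: mult_ac)
  qed
  show ?thesis
    by (rule trans[OF sum.cong[OF refl summand]])
      (simp_all only: atMost_iff sum_distrib_left[symmetric] zero mult_zero_right)
qed

section \<open>The summand of \<open>Theta\<close> in the variables \<open>u\<close> and
  \<open>v\<close>\<close>

lemma Gamma_plus_nat_mult_rGamma:
  fixes z :: complex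
  assumes "z \<notin> \<int>"
  shows "Gamma (z + of_nat k) * rGamma z = pochhammer z k"
    and "Gamma z * rGamma (z + of_nat k) = 1 / pochhammer z k"
proof -
  have "z \<notin> \<int>\<^sub>\<le>\<^sub>0" "z + of_nat k \<notin> \<int>\<^sub>\<le>\<^sub>0"
    using assms not_Ints_translate[OF assms, of "z + of_nat k"] nonpos_Ints_subset_Ints by auto
  then show "Gamma (z + of_nat k) * rGamma z = pochhammer z k"
    and "Gamma z * rGamma (z + of_nat k) = 1 / pochhammer z k"
    by (auto simp: pochhammer_Gamma rGamma_inverse_Gamma Gamma_eq_zero_iff field_simps)
qed

text \<open>Numerator and denominator factors whose arguments differ by \<open>1\<close>,
  \<open>m\<close> or \<open>m + 1\<close> collapse to Pochhammer symbols. The four factors of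
  \<open>gamma_quotient\<close> and the pair containing \<open>n\<close> remain as Gamma
  functions.\<close>

lemma Theta_summand:
  fixes a lam :: complex
  defines "\<beta> \<equiv> lam - 2 * a"
  assumes "N \<le> n" and v: "v = (1 + 2 * lam) * (of_nat N + 1/2)" "2 * v \<notin> \<int>"
  shows "prod_list (map Gamma (N_args lam a (of_nat i) (of_nat m) (of_nat n) (of_nat N))) *
     prod_list (map rGamma (D_args lam a (of_nat i) (of_nat m) (of_nat n) (of_nat N))) * ((- 1) ^ N / fact N)
   = (-1) ^ N * (of_nat N + 1/2) / (fact (n - N) * fact (n + N + 1)) *
     (Gamma (1/2 - \<beta> + v + of_nat n) * rGamma (1/2 + \<beta> + v - of_nat n)) *
     (pochhammer (v + (1 - of_nat m) / 2) m * ((v + of_nat m / 2 - of_nat i) / pochhammer (2 * v - of_nat i) (Suc m) *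
        gamma_quotient (\<beta> / 2 + of_nat m / 4) (v + of_nat m / 2 - of_nat i) (of_nat N + 1/2)))"
proof -
  define g y u where "g = \<beta> / 2 + of_nat m / 4" and "y = v + of_nat m / 2 - of_nat i"
    and "u = (of_nat N + 1/2 :: complex)"
  \<comment> \<open>Integer offsets are kept in the form \<open>of_nat\<close>, so that the quotient
    rules for Gamma match.\<close>
  have args: "(of_nat m - of_nat i) / 2 + lam - a + lam * of_nat N = g + (y - u) / 2"
    "(1 + of_nat m - of_nat i) / 2 + lam - a + (1 + lam) * of_nat N = g + (y + u) / 2"
    "(3 + of_nat m) / 2 - of_nat i + lam + (1 + 2 * lam) * of_nat N = y + of_nat 1"
    "(2 + of_nat m) / 2 + lam + (1 + 2 * lam) * of_nat N = v + (1 - of_nat m) / 2 + of_nat m"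
    "1 + 2 * a + of_nat n + (1 + 2 * lam) * of_nat N = 1/2 - \<beta> + v + of_nat n"
    "1 - of_nat i + 2 * lam + (2 + 4 * lam) * of_nat N = 2 * v - of_nat i"
    "(2 - of_nat i) / 2 + a + lam * of_nat N = 1 - g + (y - u) / 2"
    "(3 - of_nat i) / 2 + a + (1 + lam) * of_nat N = 1 - g + (y + u) / 2"
    "(1 + of_nat m) / 2 - of_nat i + lam + (1 + 2 * lam) * of_nat N = y"
    "(2 - of_nat m) / 2 + lam + (1 + 2 * lam) * of_nat N = v + (1 - of_nat m) / 2"
    "1 + 2 * lam - 2 * a - of_nat n + (1 + 2 * lam) * of_nat N = 1/2 + \<beta> + v - of_nat n"
    "2 + of_nat m - of_nat i + 2 * lam + (2 + 4 * lam) * of_nat N = 2 * v - of_nat i + of_nat (Suc m)"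
    "3/2 + of_nat N = u + of_nat 1" "1/2 + of_nat N = u"
    "1 + of_nat n - of_nat N = (of_nat (Suc (n - N)) :: complex)" "2 + of_nat n + of_nat N = (of_nat (Suc (n + N + 1)) :: complex)"
    "1 + of_nat N = (of_nat (Suc N) :: complex)"
    using assms(2) by (simp_all add: g_def y_def u_def v(1) \<beta>_def of_nat_diff field_simps)
  have eqs: "2 * y = 2 * v + of_nat m - 2 * of_nat i" "2 * (v + (1 - of_nat m) / 2) = 2 * v + 1 - of_nat m"
    by (simp_all add: y_def distrib_left right_diff_distrib)
  have "2 * y \<notin> \<int>" "2 * (v + (1 - of_nat m) / 2) \<notin> \<int>"
    unfolding eqs by (rule not_Ints_translate[OF v(2)]; simp)+
  then have nI: "y \<notin> \<int>" "v + (1 - of_nat m) / 2 \<notin> \<int>"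
    by - (rule not_Ints_if_double_not_Ints, assumption)+
  have nI': "2 * v - of_nat i \<notin> \<int>"
    by (rule not_Ints_translate[OF v(2)]) simp
  have u: "Gamma (u + of_nat 1) * rGamma u = u"
  proof -
    have "Re u > 0"
      by (simp add: u_def)
    then have "u \<notin> \<int>\<^sub>\<le>\<^sub>0"
      by (auto elim: nonpos_Ints_cases)
    then show ?thesis
      by (simp add: Gamma_plus1 rGamma_inverse_Gamma Gamma_eq_zero_iff)
  qed
  have fact: "Gamma (of_nat (Suc k)) = (fact k :: complex)" "rGamma (of_nat (Suc k)) = (1 / fact k :: complex)" for k
    using Gamma_fact[of k, where 'a = complex] by (simp_all add: rGamma_inverse_Gamma divide_inverse)
  have "prod_list (map Gamma (N_args lam a (of_nat i) (of_nat m) (of_nat n) (of_nat N))) *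
     prod_list (map rGamma (D_args lam a (of_nat i) (of_nat m) (of_nat n) (of_nat N))) * ((- 1) ^ N / fact N)
    = fact N * (Gamma (u + of_nat 1) * rGamma u) * (Gamma (g + (y - u) / 2) * Gamma (g + (y + u) / 2)
       * rGamma (1 - g + (y - u) / 2) * rGamma (1 - g + (y + u) / 2)) * (Gamma (y + of_nat 1) * rGamma y)
      * (Gamma (v + (1 - of_nat m) / 2 + of_nat m) * rGamma (v + (1 - of_nat m) / 2))
      * (Gamma (1/2 - \<beta> + v + of_nat n) * rGamma (1/2 + \<beta> + v - of_nat n))
      * (Gamma (2 * v - of_nat i) * rGamma (2 * v - of_nat i + of_nat (Suc m)))
      * (1 / fact (n - N)) * (1 / fact (n + N + 1)) * ((- 1) ^ N / fact N)"
    unfolding N_args_def D_args_def args list.map prod_list.Cons prod_list.Nil fact by (simp only: mult_ac mult_1_left mult_1_right)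
  also have "\<dots> = (-1) ^ N * u / (fact (n - N) * fact (n + N + 1)) *
     (Gamma (1/2 - \<beta> + v + of_nat n) * rGamma (1/2 + \<beta> + v - of_nat n)) *
     (pochhammer (v + (1 - of_nat m) / 2) m * (y / pochhammer (2 * v - of_nat i) (Suc m) * gamma_quotient g y u))"
    unfolding u Gamma_plus_nat_mult_rGamma[OF nI(1)] Gamma_plus_nat_mult_rGamma[OF nI(2)]
      Gamma_plus_nat_mult_rGamma[OF nI'] gamma_quotient_def
    by (simp add: mult_ac del: pochhammer_Suc fact_Suc)
  finally show ?thesis
    unfolding g_def y_def u_def .
qed

text \<open>The identity for parameters where the three non-integrality conditions keep every Gamma
  function off its poles and every denominator nonzero.\<close>

lemma Theta_sum_generic:
  fixes a lam :: complex
  defines "\<beta> \<equiv> lam - 2 * a" and "v \<equiv> \<lambda>N::nat. (1 + 2 * lam) * (of_nat N + 1/2)"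
  assumes generic: "\<And>N. N \<le> n \<Longrightarrow> 2 * v N \<notin> \<int>" "\<And>N. N \<le> n \<Longrightarrow> \<beta> + v N - 1/2 \<notin> \<int>"
      "\<And>N. N \<le> n \<Longrightarrow> \<beta> - v N - 1/2 \<notin> \<int>"
  shows "(\<Sum>i=0..m. pochhammer (- of_nat m) i / fact i * Theta lam a i m n) =
    ((- 1) ^ n * 2 powr (4 * a - 2 * lam - of_nat m - 1)
      * pochhammer (1 + 2 * a - lam + of_nat m / 2) n
      * pochhammer (lam - 2 * a - of_nat m / 2) m)
    / ((1 + 2 * a + 2 * lam * of_nat n + 2 * of_nat n) * (lam - a + lam * of_nat n) * pochhammer 1 n)"
proof -
  define W where "W = (\<lambda>N. (-1) ^ N * (of_nat N + 1/2) / (fact (n - N) * fact (n + N + 1)) :: complex)"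
  define Q where "Q = (\<lambda>k N. \<Prod>j<k. (1/2 - \<beta> + of_nat j)\<^sup>2 - ((1 + 2 * lam) * (of_nat N + 1/2))\<^sup>2)"
  define K where "K = - ((-1) ^ m * 2 powr (1 - 2 * \<beta> - of_nat m))"
  define C where "C = (\<lambda>k. pochhammer (1 - \<beta> - of_nat m / 2) (k + m) / fact k)"
  define q where "q = (\<lambda>N k. pochhammer (- of_nat N) k * pochhammer (of_nat N + 1) k :: complex)"
  define G where "G = (\<lambda>i N. (v N + of_nat m / 2 - of_nat i) / pochhammer (2 * v N - of_nat i) (Suc m) *
        gamma_quotient (\<beta> / 2 + of_nat m / 4) (v N + of_nat m / 2 - of_nat i) (of_nat N + 1/2))"
  define E where "E = (\<lambda>N. Gamma (1/2 - \<beta> + v N + of_nat n) * rGamma (1/2 + \<beta> + v N - of_nat n))"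
  have PQ: "pochhammer (1/2 - \<beta> - v N) k * pochhammer (1/2 - \<beta> + v N) k = Q k N" for k N
    unfolding Q_def pochhammer_prod atLeast0LessThan prod.distrib[symmetric] v_def
    by (intro prod.cong refl) (simp add: power2_eq_square algebra_simps)
  have nI: "1/2 - \<beta> + v N \<notin> \<int>" "1/2 - \<beta> - v N \<notin> \<int>" "1/2 + \<beta> + v N \<notin> \<int>" if "N \<le> n" for N
    using generic(2,3)[OF that] Ints_minus[of "1/2 - \<beta> + v N"] Ints_minus[of "1/2 - \<beta> - v N"]
      Ints_diff[of "1/2 + \<beta> + v N" 1] by (auto simp: algebra_simps)
  have Qnz: "(1/2 - \<beta> + of_nat j)\<^sup>2 \<noteq> ((1 + 2 * lam) * (of_nat N + 1/2))\<^sup>2" if "N \<le> n" for N j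
  proof
    assume "(1/2 - \<beta> + of_nat j)\<^sup>2 = ((1 + 2 * lam) * (of_nat N + 1/2))\<^sup>2"
    then have "1/2 - \<beta> + of_nat j = v N \<or> 1/2 - \<beta> + of_nat j = - v N"
      unfolding v_def by (simp only: power2_eq_iff)
    then have "1/2 - \<beta> - v N = - of_nat j \<or> 1/2 - \<beta> + v N = - of_nat j"
      by (auto simp: algebra_simps eq_neg_iff_add_eq_0)
    then show False
      using nI[OF that] by auto
  qed
  have "(\<Sum>i=0..m. pochhammer (- of_nat m) i / fact i * Theta lam a i m n)
     = (\<Sum>i\<le>m. \<Sum>N\<le>n. pochhammer (- of_nat m) i / fact i *
         (W N * E N * (pochhammer (v N + (1 - of_nat m) / 2) m * G i N)))"
    unfolding Theta_def sum_distrib_left atLeast0AtMost W_def E_def G_def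
    using Theta_summand[OF _ _ generic(1), where lam = lam, folded v_def \<beta>_def]
    by (intro sum.cong refl arg_cong[of _ _ "(*) _"]) (simp_all add: v_def \<beta>_def)
  also have "\<dots> = (\<Sum>N\<le>n. W N * E N * (pochhammer (v N + (1 - of_nat m) / 2) m *
      (\<Sum>i\<le>m. pochhammer (- of_nat m) i / fact i * G i N)))"
    by (subst sum.swap) (simp add: sum_distrib_left mult_ac)
  also have "\<dots> = (\<Sum>N\<le>n. \<Sum>k\<le>n. (-1) ^ n * K * C k * (W N * q N k * (Q n N / Q (Suc k) N)))"
  proof (intro sum.cong refl)
    fix N assume "N \<in> {..n}"
    then have N: "N \<le> n" by simp
    have "pochhammer (v N + (1 - of_nat m) / 2) m * (\<Sum>i\<le>m. pochhammer (- of_nat m) i / fact i * G i N)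
      = K * (Gamma (1/2 + \<beta> + v N) * rGamma (1/2 - \<beta> + v N)) *
        (\<Sum>k\<le>N. q N k * C k / Q (Suc k) N)"
      using gamma_quotient_sum[OF generic(1-3)[OF N], of m N]
      by (simp only: G_def K_def q_def C_def PQ[symmetric] times_divide_eq_right mult.assoc divide_divide_eq_left times_divide_eq_left)
    \<comment> \<open>The added terms vanish because \<open>pochhammer (- of_nat N) k\<close> is
      zero for \<open>k > N\<close>. The range of \<open>k\<close> no longer depends on
      \<open>N\<close>, so the sums can be interchanged.\<close>
    also have "(\<Sum>k\<le>N. q N k * C k / Q (Suc k) N) = (\<Sum>k\<le>n. q N k * C k / Q (Suc k) N)"
      using N by (intro sum.mono_neutral_left) (auto simp: q_def pochhammer_of_nat_eq_0_iff)
    finally have "W N * E N * (pochhammer (v N + (1 - of_nat m) / 2) m * (\<Sum>i\<le>m. pochhammer (- of_nat m) i / fact i * G i N))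
      = W N * ((Gamma (1/2 - \<beta> + v N + of_nat n) * rGamma (1/2 - \<beta> + v N)) *
          (Gamma (1/2 + \<beta> + v N) * rGamma (1/2 + \<beta> + v N - of_nat n))) * K * (\<Sum>k\<le>n. q N k * C k / Q (Suc k) N)"
      by (simp add: E_def mult_ac)
    \<comment> \<open>The pair of Gamma functions left in the summand meets the one produced by
      Whipple's sum; together they are a polynomial in the square of \<open>v N\<close>, which
      cancels the denominator \<open>Q (Suc k) N\<close> when \<open>k < n\<close>.\<close>
    also have "(Gamma (1/2 - \<beta> + v N + of_nat n) * rGamma (1/2 - \<beta> + v N)) *
          (Gamma (1/2 + \<beta> + v N) * rGamma (1/2 + \<beta> + v N - of_nat n)) = (-1) ^ n * Q n N"
    proof -
      have "1/2 + \<beta> + v N - of_nat n \<notin> \<int>"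
        by (rule not_Ints_translate[OF nI(3)[OF N]]) simp
      from Gamma_plus_nat_mult_rGamma(1)[OF this, of n]
      have "Gamma (1/2 + \<beta> + v N) * rGamma (1/2 + \<beta> + v N - of_nat n) = pochhammer (1/2 + \<beta> + v N - of_nat n) n"
        by simp
      also have "\<dots> = (-1) ^ n * pochhammer (1/2 - \<beta> - v N) n"
      proof -
        have "1 - (1/2 + \<beta> + v N - of_nat n) - of_nat n = 1/2 - \<beta> - v N"
          by simp
        then show ?thesis
          using pochhammer_reflect[of "1/2 + \<beta> + v N - of_nat n" n] by (simp only:)
      qed
      finally show ?thesis
        unfolding Gamma_plus_nat_mult_rGamma(1)[OF nI(1)[OF N]] PQ[symmetric] by simp
    qed
    finally show "W N * E N * (pochhammer (v N + (1 - of_nat m) / 2) m * (\<Sum>i\<le>m. pochhammer (- of_nat m) i / fact i * G i N))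
      = (\<Sum>k\<le>n. (-1) ^ n * K * C k * (W N * q N k * (Q n N / Q (Suc k) N)))"
      by (simp add: sum_distrib_left mult_ac)
  qed
  also have "\<dots> = (\<Sum>k\<le>n. (-1) ^ n * K * C k * (\<Sum>N\<le>n. W N * q N k * (Q n N / Q (Suc k) N)))"
    by (subst sum.swap) (simp only: sum_distrib_left)
  \<comment> \<open>For \<open>k < n\<close> the inner sum is a vanishing divided difference; for
    \<open>k = n\<close> one factor of the denominator is left over.\<close>
  also have "\<dots> = (\<Sum>k\<in>{n}. (-1) ^ n * K * C k * (\<Sum>N\<le>n. W N * q N k * (Q n N / Q (Suc k) N)))"
  proof (intro sum.mono_neutral_right ballI)
    fix k assume "k \<in> {..n} - {n}"
    then have "k < n" by auto
    have "(\<Sum>N\<le>n. W N * q N k * (Q n N / Q (Suc k) N)) = 0"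
      unfolding W_def q_def Q_def by (rule nodal_sum_eq_0[OF \<open>k < n\<close>]) (rule Qnz)
    then show "(-1) ^ n * K * C k * (\<Sum>N\<le>n. W N * q N k * (Q n N / Q (Suc k) N)) = 0"
      by simp
  qed auto
  also have "\<dots> = (-1) ^ n * K * C n * (\<Sum>N\<le>n. W N * q N n * (Q n N / Q (Suc n) N))"
    by simp
  \<comment> \<open>At \<open>k = n\<close> the symbol \<open>pochhammer (- of_nat N) n\<close>
    vanishes for all \<open>N < n\<close>.\<close>
  also have "(\<Sum>N\<le>n. W N * q N n * (Q n N / Q (Suc n) N)) = (\<Sum>N\<in>{n}. W N * q N n * (Q n N / Q (Suc n) N))"
    by (intro sum.mono_neutral_right) (auto simp: q_def pochhammer_of_nat_eq_0_iff)
  also have "\<dots> = W n * q n n / ((1/2 - \<beta> + of_nat n)\<^sup>2 - (v n)\<^sup>2)"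
  proof -
    have "Q n n \<noteq> 0"
      using Qnz[of n] by (simp add: Q_def)
    then show ?thesis
      by (simp add: Q_def v_def)
  qed
  also have "W n * q n n = 1/2"
  proof -
    have "fact n * pochhammer (of_nat n + 1) n = (fact (2 * n) :: complex)"
      using pochhammer_product'[of "1::complex" n n] by (simp add: pochhammer_fact mult_2 add.commute)
    then have "q n n = (-1) ^ n * fact (2 * n)"
      by (simp add: q_def pochhammer_same)
    moreover have "n + n + 1 = Suc (2 * n)" "of_nat n + 1/2 = (of_nat (Suc (2 * n)) / 2 :: complex)"
      by simp_all
    ultimately show ?thesis
      unfolding W_def by (simp only: fact_Suc) (simp add: power_mult_distrib[symmetric] del: of_nat_Suc)
  qed
  also have "(-1) ^ n * K * C n * (1/2 / ((1/2 - \<beta> + of_nat n)\<^sup>2 - (v n)\<^sup>2)) =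
    ((- 1) ^ n * 2 powr (4 * a - 2 * lam - of_nat m - 1)
      * pochhammer (1 + 2 * a - lam + of_nat m / 2) n
      * pochhammer (lam - 2 * a - of_nat m / 2) m)
    / ((1 + 2 * a + 2 * lam * of_nat n + 2 * of_nat n) * (lam - a + lam * of_nat n) * pochhammer 1 n)"
  proof -
    have p: "1 - 2 * \<beta> - of_nat m = (4 * a - 2 * lam - of_nat m - 1) + 2"
      by (simp add: \<beta>_def)
    have K: "K = - ((-1) ^ m * (4 * 2 powr (4 * a - 2 * lam - of_nat m - 1)))"
      unfolding K_def p powr_add by simp
    have "pochhammer (1 - \<beta> - of_nat m / 2) m = (-1) ^ m * pochhammer (lam - 2 * a - of_nat m / 2) m"
    proof -
      have "1 - (1 - \<beta> - of_nat m / 2) - of_nat m = lam - 2 * a - of_nat m / 2"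
        by (simp add: \<beta>_def field_simps)
      then show ?thesis
        using pochhammer_reflect[of "1 - \<beta> - of_nat m / 2" m] by (simp only:)
    qed
    moreover have "1 - \<beta> - of_nat m / 2 + of_nat m = 1 + 2 * a - lam + of_nat m / 2"
      by (simp add: \<beta>_def field_simps)
    ultimately have "pochhammer (1 - \<beta> - of_nat m / 2) (n + m) = (-1) ^ m *
        pochhammer (lam - 2 * a - of_nat m / 2) m * pochhammer (1 + 2 * a - lam + of_nat m / 2) n"
      using pochhammer_product'[of "1 - \<beta> - of_nat m / 2" m n] by (simp only: add.commute[of n m])
    then have C: "C n = (-1) ^ m * pochhammer (lam - 2 * a - of_nat m / 2) m *
        pochhammer (1 + 2 * a - lam + of_nat m / 2) n / pochhammer 1 n"
      by (simp only: C_def pochhammer_fact)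
    \<comment> \<open>As a difference of squares, the leftover factor splits into the two linear
      factors of the denominator in the claim.\<close>
    have D: "(1/2 - \<beta> + of_nat n)\<^sup>2 - (v n)\<^sup>2 =
       - 2 * ((1 + 2 * a + 2 * lam * of_nat n + 2 * of_nat n) * (lam - a + lam * of_nat n))"
      unfolding \<beta>_def v_def by (simp add: power2_eq_square field_simps)
    \<comment> \<open>The sign \<open>(-1)^m\<close> occurs once in \<open>K\<close> and once in
      \<open>C n\<close>.\<close>
    define s where "s = ((-1) ^ m :: complex)"
    have s: "s * s = 1"
      by (simp add: s_def power_mult_distrib[symmetric])
    have "(-1) ^ n * K * C n * (1/2 / ((1/2 - \<beta> + of_nat n)\<^sup>2 - (v n)\<^sup>2)) = (s * s) *
    (((- 1) ^ n * 2 powr (4 * a - 2 * lam - of_nat m - 1)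
      * pochhammer (1 + 2 * a - lam + of_nat m / 2) n
      * pochhammer (lam - 2 * a - of_nat m / 2) m)
    / ((1 + 2 * a + 2 * lam * of_nat n + 2 * of_nat n) * (lam - a + lam * of_nat n) * pochhammer 1 n))"
      unfolding K C D s_def[symmetric] by (simp add: mult_ac)
    then show ?thesis
      unfolding s by simp
  qed
  finally show ?thesis .
qed

section \<open>Passage from generic to arbitrary parameters by continuity\<close>

lemma eventually_affine_not_Ints:
  fixes z s :: complex
  assumes "s \<noteq> 0"
  shows "eventually (\<lambda>t. z + s * t \<notin> \<int>) (at 0)"
proof -
  \<comment> \<open>Any set of integers is closed, so near \<open>z\<close> there is no integer
    except possibly \<open>z\<close>, and \<open>z\<close> itself is avoided as \<open>s * t\<close>
    is nonzero.\<close>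
  have "closed (\<int> - {z})"
    by (rule closed_subset_Ints) auto
  then have "open (- (\<int> - {z}))"
    by (rule open_Compl)
  moreover have "((\<lambda>t. z + s * t) \<longlongrightarrow> z) (at 0)"
    by (auto intro!: tendsto_eq_intros)
  ultimately have "eventually (\<lambda>t. z + s * t \<in> - (\<int> - {z})) (at 0)"
    by (auto dest: topological_tendstoD)
  moreover have "eventually (\<lambda>t. t \<noteq> 0) (at (0 :: complex))"
    by (rule eventually_neq_at_within)
  ultimately show ?thesis
    by eventually_elim (use assms in auto)
qed

theorem theorem5:
  fixes a lam :: complex and m n :: nat
  assumes no_poles: "\<And>i k z. i \<le> m \<Longrightarrow> k \<le> n \<Longrightarrow>
      z \<in> set (N_args lam a (of_nat i) (of_nat m) (of_nat n) (of_nat k)) \<Longrightarrow> z \<notin> \<int>\<^sub>\<le>\<^sub>0"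
    and denom_nz: "(1 + 2 * a + 2 * lam * of_nat n + 2 * of_nat n) * (lam - a + lam * of_nat n)
      * pochhammer 1 n \<noteq> 0"
  shows "(\<Sum>i=0..m. pochhammer (- of_nat m) i / fact i * Theta lam a i m n) =
    ((- 1) ^ n * 2 powr (4 * a - 2 * lam - of_nat m - 1)
      * pochhammer (1 + 2 * a - lam + of_nat m / 2) n
      * pochhammer (lam - 2 * a - of_nat m / 2) m)
    / ((1 + 2 * a + 2 * lam * of_nat n + 2 * of_nat n) * (lam - a + lam * of_nat n) * pochhammer 1 n)"
proof -
  \<comment> \<open>The direction \<open>(2, 1)\<close> keeps \<open>l t - 2 * b t\<close> constant,
    so only the denominator of the right-hand side varies, while the three quantities of the generic
    case have the nonzero slopes \<open>4 d\<close>, \<open>2 d\<close> and \<open>- 2 d\<close>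
    with \<open>d = 2 N + 1\<close>.\<close>
  define l where "l = (\<lambda>t. lam + 2 * t)"
  define b where "b = (\<lambda>t. a + t)"
  define L where "L = (\<lambda>t. \<Sum>i=0..m. pochhammer (- of_nat m) i / fact i * Theta (l t) (b t) i m n)"
  define R where "R = (\<lambda>t. ((- 1) ^ n * 2 powr (4 * b t - 2 * l t - of_nat m - 1)
      * pochhammer (1 + 2 * b t - l t + of_nat m / 2) n
      * pochhammer (l t - 2 * b t - of_nat m / 2) m)
    / ((1 + 2 * b t + 2 * l t * of_nat n + 2 * of_nat n) * (l t - b t + l t * of_nat n) * pochhammer 1 n))"
  have "eventually (\<lambda>t. \<forall>N\<in>{..n}. 2 * ((1 + 2 * l t) * (of_nat N + 1/2)) \<notin> \<int> \<and>
      l t - 2 * b t + (1 + 2 * l t) * (of_nat N + 1/2) - 1/2 \<notin> \<int> \<and>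
      l t - 2 * b t - (1 + 2 * l t) * (of_nat N + 1/2) - 1/2 \<notin> \<int>) (at 0)"
  proof (intro eventually_ball_finite ballI eventually_conj)
    fix N :: nat
    define d where "d = (of_nat (2 * N + 1) :: complex)"
    have "d \<noteq> 0"
      unfolding d_def of_nat_eq_0_iff by simp
    then have nz: "4 * d \<noteq> 0" "2 * d \<noteq> 0" "- 2 * d \<noteq> 0"
      by simp_all
    show "eventually (\<lambda>t. 2 * ((1 + 2 * l t) * (of_nat N + 1/2)) \<notin> \<int>) (at 0)"
      using eventually_affine_not_Ints[OF nz(1), of "2 * ((1 + 2 * lam) * (of_nat N + 1/2))"]
      by (simp add: l_def d_def algebra_simps)
    show "eventually (\<lambda>t. l t - 2 * b t + (1 + 2 * l t) * (of_nat N + 1/2) - 1/2 \<notin> \<int>) (at 0)"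
      using eventually_affine_not_Ints[OF nz(2), of "lam - 2 * a + (1 + 2 * lam) * (of_nat N + 1/2) - 1/2"]
      by (simp add: l_def b_def d_def algebra_simps)
    show "eventually (\<lambda>t. l t - 2 * b t - (1 + 2 * l t) * (of_nat N + 1/2) - 1/2 \<notin> \<int>) (at 0)"
      using eventually_affine_not_Ints[OF nz(3), of "lam - 2 * a - (1 + 2 * lam) * (of_nat N + 1/2) - 1/2"]
      by (simp add: l_def b_def d_def algebra_simps)
  qed simp
  then have "eventually (\<lambda>t. L t = R t) (at 0)"
  proof eventually_elim
    case (elim t)
    note * = bspec[OF elim, unfolded atMost_iff]
    show ?case
      unfolding L_def R_def by (rule Theta_sum_generic; use * in blast)
  qed
  moreover have "isCont L 0"
  proof -
    have cont: "isCont l 0" "isCont b 0"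
      unfolding l_def b_def by (intro continuous_intros)+
    \<comment> \<open>Continuity of the numerator is where \<open>no_poles\<close> enters; the
      denominator is covered by continuity of the entire function \<open>rGamma\<close>.\<close>
    have N: "isCont (\<lambda>t. prod_list (map Gamma (N_args (l t) (b t) (of_nat i) (of_nat m) (of_nat n) (of_nat k)))) 0"
      if "i \<le> m" "k \<le> n" for i k
    proof -
      have "\<forall>z\<in>set (N_args (l 0) (b 0) (of_nat i) (of_nat m) (of_nat n) (of_nat k)). z \<notin> \<int>\<^sub>\<le>\<^sub>0"
        using no_poles[OF that] by (simp add: l_def b_def)
      then show ?thesis
        unfolding N_args_def list.map prod_list.Cons prod_list.Nil list.set ball_simps
        by (intro continuous_intros cont) blast+
    qed
    have D: "isCont (\<lambda>t. prod_list (map rGamma (D_args (l t) (b t) (of_nat i) (of_nat m) (of_nat n) (of_nat k)))) 0"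
      for i k
      unfolding D_args_def list.map prod_list.Cons prod_list.Nil
      by (intro continuous_intros cont)
    show ?thesis
      unfolding L_def Theta_def
      by (intro continuous_sum continuous_mult continuous_const N D) auto
  qed
  moreover have "isCont R 0"
  proof -
    have invariant: "4 * b t - 2 * l t = 4 * a - 2 * lam" "1 + 2 * b t - l t = 1 + 2 * a - lam"
        "l t - 2 * b t = lam - 2 * a" for t
      by (simp_all add: l_def b_def)
    show ?thesis
      unfolding R_def invariant unfolding l_def b_def
      by (intro continuous_intros) (use denom_nz in simp)
  qed
  \<comment> \<open>The two sides agree on a punctured neighbourhood of \<open>0\<close> and are
    continuous there, so their limits, which are their values at \<open>0\<close>, coincide.\<close>
  ultimately have "L 0 = R 0"
    unfolding isCont_def using tendsto_unique[of "at 0" L "L 0" "R 0"]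
    by (simp add: tendsto_cong)
  then show ?thesis
    by (simp only: L_def R_def l_def b_def mult_zero_right add_0_right)
qed

end
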